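(* The information decompositions $I_\cap^{\wedge}$, $I_\cap^{\mathrm{GH}}$ and $I_\cap^{*}$ are additive. That is, for each of the three decompositions, each of the associated functions $SI$, $UI$, $CI$ is additive: whenever the triple of finite random variables $(S_1,Y_1,Z_1)$ is independent of the triple of finite random variables $(S_2,Y_2,Z_2)$, $$SI(S_1S_2;Y_1Y_2,Z_1Z_2)=SI(S_1;Y_1,Z_1)+SI(S_2;Y_2,Z_2),$$ and likewise for $UI(S;Y\setminus Z)$, $UI(S;Z\setminus Y)$ and $CI(S;Y,Z)$.
   Context: All random variables $S,Y,Z$ have finite state spaces; $P$ denotes their joint distribution. $I(\cdot\,;\cdot)$ and $I(\cdot\,;\cdot|\cdot)$ denote Shannon (conditional) mutual information. $S_1S_2$ denotes the random variable $(S_1,S_2)$, etc. A bivariate information decomposition consists of functions $SI,UI,CI$ of the joint distribution satisfying $I(S;YZ)=SI(S;Y,Z)+CI(S;Y,Z)+UI(S;Y\setminus Z)+UI(S;Z\setminus Y)$, $I(S;Y)=SI(S;Y,Z)+UI(S;Y\setminus Z)$ and $I(S;Z)=SI(S;Y,Z)+UI(S;Z\setminus Y)$. The function $SI$ determines $UI$ and $CI$ through these equations. The three decompositions are defined by the following shared information functions, where $Q$ is a finite-valued random variable: - $SI_\cap^{\wedge}(S;Y,Z)=\max\{I(Q;S): Q=f(Y)=f'(Z)\text{ almost surely}\}$, over all pairs of deterministic functions $f,f'$. - $SI_\cap^{\mathrm{GH}}(S;Y,Z)=\max\{I(Q;S): I(S;Q|Y)=I(S;Q|Z)=0\}$, over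 all joint distributions of four random variables $S,Y,Z,Q$ that extend the joint distribution of $S,Y,Z$. - $SI_\cap^{*}(S;Y,Z)=\max\{I(Q;S): P(s,q)=\sum_yP(s,y)\lambda_{q|y}=\sum_zP(s,z)\lambda'_{q|z}\text{ for all }s,q\}$, over all pairs of stochastic matrices $\lambda_{q|y},\lambda'_{q|z}$ (with $\sum_q\lambda_{q|y}=1$ and $\sum_q\lambda'_{q|z}=1$); here $P(s,q)$ is the resulting joint distribution of $(S,Q)$. *)

theory Defs
  imports "HOL-Probability.Probability"
begin

text \<open>
  A finite-valued random variable is a function on a discrete probability space (a \<open>pmf\<close>) with
  values in a finite type, or, for the auxiliary variable \<open>Q\<close>, whose alphabet is an arbitrary finite
  set, a \<open>nat\<close>-valued one taking only finitely many values. All these codomains are countable, so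
  \<open>count_space UNIV\<close> is the right (sigma-finite) structure for the library's mutual information.
  The logarithm has base \<open>b\<close>.
\<close>

definition mutual_info :: "real \<Rightarrow> 'w pmf \<Rightarrow> ('w \<Rightarrow> 'a) \<Rightarrow> ('w \<Rightarrow> 'c) \<Rightarrow> real" where
  "mutual_info b P X Y =
     prob_space.mutual_information (measure_pmf P) b (count_space UNIV) (count_space UNIV) X Y"

text \<open>\<open>cond_mutual_info b P X Y Z\<close> is \<open>I(X;Y|Z)\<close>.\<close>

definition cond_mutual_info ::
  "real \<Rightarrow> 'w pmf \<Rightarrow> ('w \<Rightarrow> 'a) \<Rightarrow> ('w \<Rightarrow> 'c) \<Rightarrow> ('w \<Rightarrow> 'd) \<Rightarrow> real" where
  "cond_mutual_info b P X Y Z =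
     prob_space.conditional_mutual_information (measure_pmf P) b
       (count_space UNIV) (count_space UNIV) (count_space UNIV) X Y Z"

definition independent :: "'w pmf \<Rightarrow> ('w \<Rightarrow> 'a) \<Rightarrow> ('w \<Rightarrow> 'c) \<Rightarrow> bool" where
  "independent P X Y \<longleftrightarrow> map_pmf (\<lambda>w. (X w, Y w)) P = pair_pmf (map_pmf X P) (map_pmf Y P)"

definition joint_dist ::
  "'w pmf \<Rightarrow> ('w \<Rightarrow> 's) \<Rightarrow> ('w \<Rightarrow> 'y) \<Rightarrow> ('w \<Rightarrow> 'z) \<Rightarrow> ('s \<times> 'y \<times> 'z) pmf" where
  "joint_dist P S Y Z = map_pmf (\<lambda>w. (S w, Y w, Z w)) P"

text \<open>
  The shared information functions, as functions of the joint distribution \<open>P\<close> of \<open>(S,Y,Z)\<close>.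
  The maximum over the choices of \<open>Q\<close> is written as the supremum in \<open>real\<close> of the (nonempty,
  bounded) set of admissible values.
\<close>

definition SI_wedge ::
  "real \<Rightarrow> ('s::finite \<times> 'y::finite \<times> 'z::finite) pmf \<Rightarrow> real" where
  "SI_wedge b P = Sup {mutual_info b P (\<lambda>(s,y,z). f y) (\<lambda>(s,y,z). s) | (f :: 'y \<Rightarrow> nat) (f' :: 'z \<Rightarrow> nat).
     AE (s,y,z) in measure_pmf P. f y = f' z}"

definition SI_GH ::
  "real \<Rightarrow> ('s::finite \<times> 'y::finite \<times> 'z::finite) pmf \<Rightarrow> real" where
  "SI_GH b P = Sup {mutual_info b R (\<lambda>(s,y,z,q). q) (\<lambda>(s,y,z,q). s) | (R :: ('s \<times> 'y \<times> 'z \<times> nat) pmf).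
     finite (set_pmf R) \<and>
     map_pmf (\<lambda>(s,y,z,q). (s,y,z)) R = P \<and>
     cond_mutual_info b R (\<lambda>(s,y,z,q). s) (\<lambda>(s,y,z,q). q) (\<lambda>(s,y,z,q). y) = 0 \<and>
     cond_mutual_info b R (\<lambda>(s,y,z,q). s) (\<lambda>(s,y,z,q). q) (\<lambda>(s,y,z,q). z) = 0}"

text \<open>
  A stochastic matrix \<open>\<lambda>\<^bsub>q|y\<^esub>\<close> is a function from \<open>y\<close> to a finitely supported distribution on the
  alphabet of \<open>Q\<close>; \<open>R\<close> is the resulting joint distribution of \<open>(S,Q)\<close>.
\<close>

definition SI_star ::
  "real \<Rightarrow> ('s::finite \<times> 'y::finite \<times> 'z::finite) pmf \<Rightarrow> real" where
  "SI_star b P = Sup {mutual_info b R (\<lambda>(s,q). q) (\<lambda>(s,q). s) |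
     (R :: ('s \<times> nat) pmf) (L :: 'y \<Rightarrow> nat pmf) (L' :: 'z \<Rightarrow> nat pmf).
     (\<forall>y. finite (set_pmf (L y))) \<and> (\<forall>z. finite (set_pmf (L' z))) \<and>
     (\<forall>s q. pmf R (s,q) = (\<Sum>y\<in>UNIV. pmf (map_pmf (\<lambda>(s,y,z). (s,y)) P) (s,y) * pmf (L y) q) \<and>
            pmf R (s,q) = (\<Sum>z\<in>UNIV. pmf (map_pmf (\<lambda>(s,y,z). (s,z)) P) (s,z) * pmf (L' z) q))}"

text \<open>
  The unique and complementary information obtained from a shared information function \<open>SI\<close> by
  solving \<open>I(S;Y) = SI + UI(S;Y\Z)\<close>, \<open>I(S;Z) = SI + UI(S;Z\Y)\<close> and
  \<open>I(S;YZ) = SI + CI + UI(S;Y\Z) + UI(S;Z\Y)\<close>; \<open>UI_Y\<close> is \<open>UI(S;Y\Z)\<close> and \<open>UI_Z\<close> is \<open>UI(S;Z\Y)\<close>.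
\<close>

definition UI_Y ::
  "(real \<Rightarrow> ('s \<times> 'y \<times> 'z) pmf \<Rightarrow> real) \<Rightarrow> real \<Rightarrow> ('s \<times> 'y \<times> 'z) pmf \<Rightarrow> real" where
  "UI_Y SI b P = mutual_info b P (\<lambda>(s,y,z). s) (\<lambda>(s,y,z). y) - SI b P"

definition UI_Z ::
  "(real \<Rightarrow> ('s \<times> 'y \<times> 'z) pmf \<Rightarrow> real) \<Rightarrow> real \<Rightarrow> ('s \<times> 'y \<times> 'z) pmf \<Rightarrow> real" where
  "UI_Z SI b P = mutual_info b P (\<lambda>(s,y,z). s) (\<lambda>(s,y,z). z) - SI b P"

definition CI ::
  "(real \<Rightarrow> ('s \<times> 'y \<times> 'z) pmf \<Rightarrow> real) \<Rightarrow> real \<Rightarrow> ('s \<times> 'y \<times> 'z) pmf \<Rightarrow> real" where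
  "CI SI b P = mutual_info b P (\<lambda>(s,y,z). s) (\<lambda>(s,y,z). (y,z)) - SI b P - UI_Y SI b P - UI_Z SI b P"

end

theory Submission
  imports Defs
begin

text \<open>
  Mutual information of finitely supported variables is a linear combination of entropies, so
  independence and strong subadditivity are the only tools needed. Superadditivity of each shared
  information holds because a pair of admissible variables \<open>(Q\<^sub>1,Q\<^sub>2)\<close> is admissible for the product.
  Conversely, for \<open>SI\<^sup>G\<^sup>H\<close> and \<open>SI\<^sup>*\<close> use the chain rule
  \<open>I(Q;S\<^sub>1S\<^sub>2) = I(Q;S\<^sub>1) + I(QS\<^sub>1;S\<^sub>2)\<close>, valid since \<open>S\<^sub>1\<close> and \<open>S\<^sub>2\<close> are independent: if \<open>Q\<close> is
  admissible for the product, then \<open>Q\<close> is admissible for the first system and \<open>(Q,S\<^sub>1)\<close> for the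
  second. For \<open>SI\<^sup>\<and>\<close>, a common function \<open>f(Y\<^sub>1,Y\<^sub>2) = f'(Z\<^sub>1,Z\<^sub>2)\<close> is a function of the common functions
  \<open>Y\<^sub>1 \<mapsto> f(Y\<^sub>1,\<cdot>)\<close> and \<open>Y\<^sub>2 \<mapsto> f(\<cdot>,Y\<^sub>2)\<close> of the two systems, and data processing applies.
\<close>

section \<open>Entropy of finitely supported distributions\<close>

text \<open>As an expectation under \<open>M\<close>, the entropy is transported along
  \<open>map_pmf\<close> by \<open>integral_map_pmf\<close> alone.\<close>

definition pmf_entropy :: "real \<Rightarrow> 'a pmf \<Rightarrow> real" where
  "pmf_entropy b M = measure_pmf.expectation M (\<lambda>x. - log b (pmf M x))"

section \<open>Measure-theoretic information as a combination of entropies\<close>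

lemma distributed_map_pmf:
  "distributed (measure_pmf P) (count_space UNIV) X (\<lambda>x. ennreal (pmf (map_pmf X P) x))"
  unfolding distributed_def
  by (simp flip: map_pmf_rep_eq measure_pmf_eq_density)

lemma entropy_eq_pmf_entropy:
  assumes "1 < b"
  shows "prob_space.entropy (measure_pmf P) b (count_space UNIV) X = pmf_entropy b (map_pmf X P)"
proof -
  interpret information_space "measure_pmf P" b
    by unfold_locales (fact assms)
  have "prob_space.entropy (measure_pmf P) b (count_space UNIV) X =
      - (\<integral>x. pmf (map_pmf X P) x * log b (pmf (map_pmf X P) x) \<partial>count_space UNIV)"
    by (rule entropy_distr[OF distributed_map_pmf]) simp
  also have "\<dots> = pmf_entropy b (map_pmf X P)"
    unfolding pmf_entropy_def measure_pmf_eq_density[of "map_pmf X P"]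
    by (subst integral_density) auto
  finally show ?thesis .
qed

text \<open>Supplies the integrability side conditions of the general density formula used in
  \<open>mutual_info_finite_pmf\<close>.\<close>

lemma integrable_pmf_mult_finite:
  fixes M :: "'a pmf" and g :: "'a \<Rightarrow> real"
  assumes "finite (set_pmf M)"
  shows "integrable (count_space UNIV) (\<lambda>x. pmf M x * g x)"
proof -
  have "integrable (density (count_space UNIV) (\<lambda>x. ennreal (pmf M x))) g"
    using integrable_measure_pmf_finite[OF assms, of g] by (simp flip: measure_pmf_eq_density)
  then show ?thesis by (subst (asm) integrable_density) auto
qed

text \<open>Countability makes the product of the two counting spaces a counting space again, so
  \<open>distributed_map_pmf\<close> also gives the density of the pair.\<close>

lemma mutual_info_finite_pmf:
  fixes X :: "'w \<Rightarrow> 'a::countable" and Y :: "'w \<Rightarrow> 'c::countable"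
  assumes b: "1 < b" and fin: "finite (set_pmf P)"
  shows "mutual_info b P X Y =
    pmf_entropy b (map_pmf X P) + pmf_entropy b (map_pmf Y P) - pmf_entropy b (map_pmf (\<lambda>w. (X w, Y w)) P)"
proof -
  interpret information_space "measure_pmf P" b
    by unfold_locales (fact b)
  let ?J = "map_pmf (\<lambda>w. (X w, Y w)) P"
  have pair: "count_space (UNIV :: 'a set) \<Otimes>\<^sub>M count_space (UNIV :: 'c set) = count_space UNIV"
    by (simp add: pair_measure_countable)
  have J: "distributed (measure_pmf P) (count_space UNIV \<Otimes>\<^sub>M count_space UNIV) (\<lambda>w. (X w, Y w))
      (\<lambda>x. ennreal (pmf ?J x))"
    unfolding pair by (rule distributed_map_pmf)
  have "prob_space.mutual_information (measure_pmf P) b (count_space UNIV) (count_space UNIV) X Y =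
     prob_space.entropy (measure_pmf P) b (count_space UNIV) X + prob_space.entropy (measure_pmf P) b (count_space UNIV) Y
     - prob_space.entropy (measure_pmf P) b (count_space UNIV \<Otimes>\<^sub>M count_space UNIV) (\<lambda>w. (X w, Y w))"
    by (rule mutual_information_eq_entropy_conditional_entropy_distr
       [OF _ _ distributed_map_pmf _ distributed_map_pmf _ J])
      (auto simp: pair intro!: sigma_finite_measure_count_space_countable integrable_pmf_mult_finite[of ?J] fin)
  then show ?thesis
    unfolding mutual_info_def pair by (simp only: entropy_eq_pmf_entropy[OF b])
qed

text \<open>The conditional quantity is by definition I(X;YZ) - I(X;Z), and in this difference H(X)
  cancels.\<close>

lemma cond_mutual_info_finite_pmf:
  fixes X :: "'w \<Rightarrow> 'a::countable" and Y :: "'w \<Rightarrow> 'c::countable" and Z :: "'w \<Rightarrow> 'd::countable"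
  assumes b: "1 < b" and fin: "finite (set_pmf P)"
  shows "cond_mutual_info b P X Y Z =
    pmf_entropy b (map_pmf (\<lambda>w. (X w, Z w)) P) + pmf_entropy b (map_pmf (\<lambda>w. (Y w, Z w)) P)
    - pmf_entropy b (map_pmf (\<lambda>w. (X w, Y w, Z w)) P) - pmf_entropy b (map_pmf Z P)"
proof -
  have pair: "count_space (UNIV :: 'c set) \<Otimes>\<^sub>M count_space (UNIV :: 'd set) = count_space UNIV"
    by (simp add: pair_measure_countable)
  have "cond_mutual_info b P X Y Z = mutual_info b P X (\<lambda>w. (Y w, Z w)) - mutual_info b P X Z"
    unfolding cond_mutual_info_def mutual_info_def
      prob_space.conditional_mutual_information_def[OF prob_space_measure_pmf] pair ..
  then show ?thesis
    by (simp add: mutual_info_finite_pmf[OF b fin])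
qed

section \<open>Entropy under relabelling and products\<close>

lemma pmf_entropy_map_inj:
  assumes "inj_on f (set_pmf M)"
  shows "pmf_entropy b (map_pmf f M) = pmf_entropy b M"
  unfolding pmf_entropy_def integral_map_pmf
  by (intro integral_cong_AE) (auto simp: AE_measure_pmf_iff pmf_map_inj[OF assms])

text \<open>\<open>X\<close> and \<open>Y\<close> are the two projections of their pair, and both
  are injective on its support. Later this re-brackets, permutes and de-duplicates tuples of
  variables.\<close>

lemma pmf_entropy_cong_inj:
  assumes "\<And>w w'. w \<in> set_pmf P \<Longrightarrow> w' \<in> set_pmf P \<Longrightarrow> X w = X w' \<longleftrightarrow> Y w = Y w'"
  shows "pmf_entropy b (map_pmf X P) = pmf_entropy b (map_pmf Y P)"
proof -
  let ?J = "map_pmf (\<lambda>w. (X w, Y w)) P"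
  have "inj_on fst (set_pmf ?J)" "inj_on snd (set_pmf ?J)"
    using assms by (auto simp: inj_on_def)
  from this[THEN pmf_entropy_map_inj] show ?thesis
    by (simp add: pmf.map_comp comp_def)
qed

text \<open>On the support both factors are positive, so the logarithm of the product density
  splits.\<close>

lemma pmf_entropy_pair:
  assumes "finite (set_pmf A)" "finite (set_pmf B)"
  shows "pmf_entropy b (pair_pmf A B) = pmf_entropy b A + pmf_entropy b B"
proof -
  have fin: "finite (set_pmf (pair_pmf A B))" using assms by simp
  note [simp] = integrable_measure_pmf_finite[OF fin]
  have "pmf_entropy b (pair_pmf A B) =
      measure_pmf.expectation (pair_pmf A B) (\<lambda>x. - log b (pmf A (fst x)) - log b (pmf B (snd x)))"
    unfolding pmf_entropy_def
    by (intro integral_cong_AE AE_pmfI) (auto simp: pmf_pair log_mult set_pmf_iff)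
  then show ?thesis
    by (simp add: pmf_entropy_def expectation_pair_pmf_fst[where f = "\<lambda>x. log b (pmf A x)"]
        expectation_pair_pmf_snd[where f = "\<lambda>x. log b (pmf B x)"])
qed

section \<open>Gibbs' inequality and strong subadditivity\<close>

lemma gibbs_pmf:
  fixes M :: "'a pmf" and q :: "'a \<Rightarrow> real"
  assumes b: "1 < b" and B: "finite B" "set_pmf M \<subseteq> B"
    and q_nn: "\<And>x. x \<in> B \<Longrightarrow> 0 \<le> q x" and q_sum: "sum q B \<le> 1"
    and q_pos: "\<And>x. x \<in> set_pmf M \<Longrightarrow> 0 < q x"
  shows "0 \<le> measure_pmf.expectation M (\<lambda>x. log b (pmf M x / q x))" (is "0 \<le> ?E")
proof -
  \<comment> \<open>The slack in ln t \<le> t - 1 at t = q/p, weighted by p; off the support it is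
    just \<open>q x\<close>. Summed over \<open>B\<close> it gives \<open>sum q B\<close> - 1 plus
    the expectation times ln b, so nonnegativity of \<open>d\<close> yields the claim.\<close>
  define d where "d x = q x - pmf M x + pmf M x * ln (pmf M x / q x)" for x
  have d_pos: "d x = pmf M x * (q x / pmf M x - 1 - ln (q x / pmf M x))"
    if "x \<in> set_pmf M" for x
    using that q_pos[OF that] unfolding d_def
    by (simp add: pmf_positive_iff[symmetric] ln_div field_simps)
  have d_zero: "d x = q x" if "x \<notin> set_pmf M" for x
    using that by (simp add: d_def set_pmf_iff)
  have d_nn: "0 \<le> d x" if "x \<in> B" for x
  proof (cases "x \<in> set_pmf M")
    case True
    then have "0 < q x / pmf M x" using q_pos by (simp add: pmf_positive_iff)
    then show ?thesis
      using ln_le_minus_one[of "q x / pmf M x"] by (simp add: d_pos[OF True])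
  qed (use that q_nn d_zero in simp)
  have E: "?E * ln b = (\<Sum>x\<in>B. pmf M x * ln (pmf M x / q x))"
    using b B by (subst integral_measure_pmf_real[of B])
      (auto simp: log_def sum_distrib_left mult.commute intro!: sum.cong)
  have "sum (pmf M) B = 1" using B by (rule sum_pmf_eq_1)
  then have sum_d: "sum d B \<le> ?E * ln b"
    using q_sum by (simp add: d_def E sum.distrib sum_subtractf)
  then have "0 \<le> ?E * ln b" using sum_nonneg[of B d] d_nn by force
  then show ?thesis using b by (simp add: zero_le_mult_iff)
qed

lemma sum_pmf_fst:
  assumes "finite A" "fst ` set_pmf J \<subseteq> A"
  shows "(\<Sum>x\<in>A. pmf J (x, z)) = pmf (map_pmf snd J) z"
proof -
  have "pmf (map_pmf snd J) z = measure J (snd -` {z})" by (simp add: pmf_map)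
  also have "\<dots> = measure J (A \<times> {z})"
    using assms by (intro measure_pmf.finite_measure_eq_AE) (auto simp: AE_measure_pmf_iff)
  also have "\<dots> = (\<Sum>x\<in>A \<times> {z}. pmf J x)"
    using assms by (intro measure_measure_pmf_finite) auto
  also have "\<dots> = (\<Sum>x\<in>A. pmf J (x, z))"
    by (simp add: sum.cartesian_product')
  finally show ?thesis ..
qed

text \<open>Gibbs' inequality is applied to the law that keeps the marginals of (X,Z) and (Y,Z) but
  makes X and Y conditionally independent given Z; the resulting relative entropy is
  I(X;Y|Z).\<close>

lemma pmf_entropy_strong_subadditive:
  fixes M :: "('x \<times> 'y \<times> 'z) pmf"
  defines "XZ \<equiv> map_pmf (\<lambda>(x, y, z). (x, z)) M"
    and "YZ \<equiv> map_pmf (\<lambda>(x, y, z). (y, z)) M"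
    and "Z \<equiv> map_pmf (\<lambda>(x, y, z). z) M"
  assumes b: "1 < b" and fin: "finite (set_pmf M)"
  shows "pmf_entropy b M + pmf_entropy b Z \<le> pmf_entropy b XZ + pmf_entropy b YZ"
proof -
  \<comment> \<open>This is p(x,z) p(y,z) / p(z), the conditionally independent law.\<close>
  define q where "q = (\<lambda>(x, y, z). pmf XZ (x, z) * pmf YZ (y, z) / pmf Z z)"
  define A where "A = (\<lambda>(x, y, z). x) ` set_pmf M"
  define B where "B = (\<lambda>(x, y, z). y) ` set_pmf M"
  define C where "C = set_pmf Z"
  have fins: "finite A" "finite B" "finite C"
    using fin by (simp_all add: A_def B_def C_def Z_def)
  have Z: "map_pmf snd XZ = Z" "map_pmf snd YZ = Z"
    by (simp_all add: XZ_def YZ_def Z_def pmf.map_comp comp_def case_prod_unfold)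
  have pos: "pmf XZ (x, z) > 0 \<and> pmf YZ (y, z) > 0 \<and> pmf Z z > 0"
    if "(x, y, z) \<in> set_pmf M" for x y z
    using that unfolding pmf_positive_iff XZ_def YZ_def Z_def by force
  have "sum q (A \<times> B \<times> C) = (\<Sum>x\<in>A. \<Sum>y\<in>B. \<Sum>z\<in>C. pmf XZ (x, z) * pmf YZ (y, z) / pmf Z z)"
    by (simp add: q_def sum.cartesian_product')
  \<comment> \<open>For fixed z the double sum factors, and each factor is the marginal
    p(z).\<close>
  also have "\<dots> = (\<Sum>z\<in>C. (\<Sum>x\<in>A. pmf XZ (x, z)) * (\<Sum>y\<in>B. pmf YZ (y, z)) / pmf Z z)"
    by (simp add: sum.swap[of _ C] sum_product sum_divide_distrib)
  also have "\<dots> = (\<Sum>z\<in>C. pmf Z z * pmf Z z / pmf Z z)"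
  proof -
    have "(\<Sum>x\<in>A. pmf XZ (x, z)) = pmf Z z" "(\<Sum>y\<in>B. pmf YZ (y, z)) = pmf Z z" for z
      using sum_pmf_fst[of A XZ z] sum_pmf_fst[of B YZ z] fins unfolding Z
      by (auto simp: XZ_def YZ_def A_def B_def image_image case_prod_unfold)
    then show ?thesis by simp
  qed
  also have "\<dots> = sum (pmf Z) C"
    by (intro sum.cong refl) (simp add: C_def set_pmf_iff)
  also have "\<dots> = 1" using fins by (intro sum_pmf_eq_1) (auto simp: C_def)
  finally have q_sum: "sum q (A \<times> B \<times> C) \<le> 1" by simp
  have q_nn: "0 \<le> q t" for t by (simp add: q_def split_beta)
  have q_pos: "0 < q t" if "t \<in> set_pmf M" for t
    using that pos by (cases t) (auto simp: q_def)
  have sub: "set_pmf M \<subseteq> A \<times> B \<times> C"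
    by (force simp: A_def B_def C_def Z_def)
  note [simp] = integrable_measure_pmf_finite[OF fin]
  have "measure_pmf.expectation M (\<lambda>t. log b (pmf M t / q t)) =
    measure_pmf.expectation M (\<lambda>(x, y, z). log b (pmf M (x, y, z)) + log b (pmf Z z)
      - log b (pmf XZ (x, z)) - log b (pmf YZ (y, z)))"
  proof (intro integral_cong_AE AE_pmfI)
    fix t assume t: "t \<in> set_pmf M"
    obtain x y z where [simp]: "t = (x, y, z)" by (cases t)
    have "pmf M t > 0" using t by (simp only: pmf_positive_iff)
    with pos[of x y z] t
    show "log b (pmf M t / q t) = (case t of (x, y, z) \<Rightarrow> log b (pmf M (x, y, z)) + log b (pmf Z z)
      - log b (pmf XZ (x, z)) - log b (pmf YZ (y, z)))"
      by (simp add: q_def log_divide log_mult)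
  qed auto
  also have "\<dots> = pmf_entropy b XZ + pmf_entropy b YZ - pmf_entropy b M - pmf_entropy b Z"
    unfolding pmf_entropy_def by (simp add: XZ_def YZ_def Z_def case_prod_unfold)
  finally have E: "measure_pmf.expectation M (\<lambda>t. log b (pmf M t / q t)) = \<dots>" .
  then show ?thesis
    using gibbs_pmf[OF b _ sub q_nn q_sum q_pos] fins by simp
qed

lemma pmf_entropy_triple_le:
  assumes "1 < b" "finite (set_pmf P)"
  shows "pmf_entropy b (map_pmf (\<lambda>w. (X w, Y w, Z w)) P) + pmf_entropy b (map_pmf Z P)
    \<le> pmf_entropy b (map_pmf (\<lambda>w. (X w, Z w)) P) + pmf_entropy b (map_pmf (\<lambda>w. (Y w, Z w)) P)"
  using pmf_entropy_strong_subadditive[OF assms(1), of "map_pmf (\<lambda>w. (X w, Y w, Z w)) P"] assms(2)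
  by (simp add: pmf.map_comp comp_def)

text \<open>H(Y|X) = I(Y;Y|X), so strong subadditivity with a repeated variable gives its
  nonnegativity.\<close>

lemma pmf_entropy_map_le:
  assumes "1 < b" "finite (set_pmf P)"
  shows "pmf_entropy b (map_pmf X P) \<le> pmf_entropy b (map_pmf (\<lambda>w. (X w, Y w)) P)"
proof -
  have "pmf_entropy b (map_pmf (\<lambda>w. (Y w, Y w, X w)) P) = pmf_entropy b (map_pmf (\<lambda>w. (X w, Y w)) P)"
    "pmf_entropy b (map_pmf (\<lambda>w. (Y w, X w)) P) = pmf_entropy b (map_pmf (\<lambda>w. (X w, Y w)) P)"
    by (auto intro!: pmf_entropy_cong_inj)
  then show ?thesis
    using pmf_entropy_triple_le[OF assms, of Y Y X] by simp
qed

section \<open>Entropy of independent variables\<close>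

lemma independent_compose:
  assumes "independent P X Y"
  shows "independent P (\<lambda>w. f (X w)) (\<lambda>w. g (Y w))"
proof -
  have "map_pmf (\<lambda>w. (f (X w), g (Y w))) P = map_pmf (\<lambda>(x, y). (f x, g y)) (map_pmf (\<lambda>w. (X w, Y w)) P)"
    by (simp add: pmf.map_comp comp_def)
  then show ?thesis
    using assms unfolding independent_def by (simp add: map_pair pmf.map_comp comp_def)
qed

lemma pmf_entropy_independent:
  assumes "independent P X Y" "finite (set_pmf P)"
  shows "pmf_entropy b (map_pmf (\<lambda>w. (X w, Y w)) P) = pmf_entropy b (map_pmf X P) + pmf_entropy b (map_pmf Y P)"
  using assms unfolding independent_def by (simp add: pmf_entropy_pair)

section \<open>Mutual information of finitely supported distributions\<close>

lemma mutual_info_map_pmf: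
  fixes X :: "'v \<Rightarrow> 'a::countable" and Y :: "'v \<Rightarrow> 'c::countable"
  assumes "1 < b" "finite (set_pmf P)"
  shows "mutual_info b (map_pmf f P) X Y = mutual_info b P (\<lambda>w. X (f w)) (\<lambda>w. Y (f w))"
  using assms by (simp add: mutual_info_finite_pmf pmf.map_comp comp_def)

lemma cond_mutual_info_map_pmf:
  fixes X :: "'v \<Rightarrow> 'a::countable" and Y :: "'v \<Rightarrow> 'c::countable" and Z :: "'v \<Rightarrow> 'd::countable"
  assumes "1 < b" "finite (set_pmf P)"
  shows "cond_mutual_info b (map_pmf f P) X Y Z
    = cond_mutual_info b P (\<lambda>w. X (f w)) (\<lambda>w. Y (f w)) (\<lambda>w. Z (f w))"
  using assms by (simp add: cond_mutual_info_finite_pmf pmf.map_comp comp_def)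

text \<open>The auxiliary variable Q must be \<open>nat\<close>-valued, so pairs are coded by
  \<open>to_nat\<close>; this removes the coding again.\<close>

lemma mutual_info_inj:
  fixes X :: "'w \<Rightarrow> 'a::countable" and Y :: "'w \<Rightarrow> 'c::countable" and f :: "'a \<Rightarrow> 'd::countable"
  assumes "1 < b" "finite (set_pmf P)" "inj f"
  shows "mutual_info b P (\<lambda>w. f (X w)) Y = mutual_info b P X Y"
proof -
  have "pmf_entropy b (map_pmf (\<lambda>w. f (X w)) P) = pmf_entropy b (map_pmf X P)"
    "pmf_entropy b (map_pmf (\<lambda>w. (f (X w), Y w)) P) = pmf_entropy b (map_pmf (\<lambda>w. (X w, Y w)) P)"
    using assms(3) by (auto intro!: pmf_entropy_cong_inj dest: injD)
  then show ?thesis using assms(1,2) by (simp add: mutual_info_finite_pmf)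
qed

lemma cond_mutual_info_inj:
  fixes X :: "'w \<Rightarrow> 'a::countable" and Y :: "'w \<Rightarrow> 'c::countable" and Z :: "'w \<Rightarrow> 'e::countable"
    and f :: "'c \<Rightarrow> 'd::countable"
  assumes "1 < b" "finite (set_pmf P)" "inj f"
  shows "cond_mutual_info b P X (\<lambda>w. f (Y w)) Z = cond_mutual_info b P X Y Z"
proof -
  have "pmf_entropy b (map_pmf (\<lambda>w. (f (Y w), Z w)) P) = pmf_entropy b (map_pmf (\<lambda>w. (Y w, Z w)) P)"
    "pmf_entropy b (map_pmf (\<lambda>w. (X w, f (Y w), Z w)) P) = pmf_entropy b (map_pmf (\<lambda>w. (X w, Y w, Z w)) P)"
    using assms(3) by (auto intro!: pmf_entropy_cong_inj dest: injD)
  then show ?thesis using assms(1,2) by (simp add: cond_mutual_info_finite_pmf)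
qed

text \<open>H(X) \<le> H(X,Y) gives the bound. With Y = S it does not depend on Q, which makes the
  suprema well behaved.\<close>

lemma mutual_info_le_entropy:
  fixes X :: "'w \<Rightarrow> 'a::countable" and Y :: "'w \<Rightarrow> 'c::countable"
  assumes "1 < b" "finite (set_pmf P)"
  shows "mutual_info b P X Y \<le> pmf_entropy b (map_pmf Y P)"
  using pmf_entropy_map_le[OF assms, of X Y] by (simp add: mutual_info_finite_pmf[OF assms])

text \<open>This is I(X';Y|X) \<ge> 0, where \<open>X\<close> is absorbed into \<open>X'\<close> in
  every entropy because \<open>X'\<close> determines it on the support.\<close>

lemma mutual_info_data_processing:
  fixes X :: "'w \<Rightarrow> 'a::countable" and X' :: "'w \<Rightarrow> 'd::countable" and Y :: "'w \<Rightarrow> 'c::countable"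
  assumes b: "1 < b" and fin: "finite (set_pmf P)"
    and det: "\<And>w w'. w \<in> set_pmf P \<Longrightarrow> w' \<in> set_pmf P \<Longrightarrow> X' w = X' w' \<Longrightarrow> X w = X w'"
  shows "mutual_info b P X Y \<le> mutual_info b P X' Y"
proof -
  have "pmf_entropy b (map_pmf (\<lambda>w. (X' w, Y w, X w)) P) = pmf_entropy b (map_pmf (\<lambda>w. (X' w, Y w)) P)"
    "pmf_entropy b (map_pmf (\<lambda>w. (X' w, X w)) P) = pmf_entropy b (map_pmf X' P)"
    "pmf_entropy b (map_pmf (\<lambda>w. (Y w, X w)) P) = pmf_entropy b (map_pmf (\<lambda>w. (X w, Y w)) P)"
    using det by (auto intro!: pmf_entropy_cong_inj)
  then show ?thesis
    using pmf_entropy_triple_le[OF b fin, of X' Y X] by (simp add: mutual_info_finite_pmf[OF b fin])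
qed

text \<open>In general the second term is I(Q;S2|S1); it equals I(QS1;S2) because I(S1;S2) = 0. In
  entropies, H(Q,S1) cancels and H(S1,S2) splits.\<close>

lemma mutual_info_chain_independent:
  fixes Q :: "'w \<Rightarrow> 'a::countable" and S1 :: "'w \<Rightarrow> 'c::countable" and S2 :: "'w \<Rightarrow> 'd::countable"
  assumes b: "1 < b" and fin: "finite (set_pmf P)" and ind: "independent P S1 S2"
  shows "mutual_info b P Q (\<lambda>w. (S1 w, S2 w)) = mutual_info b P Q S1 + mutual_info b P (\<lambda>w. (Q w, S1 w)) S2"
proof -
  have "pmf_entropy b (map_pmf (\<lambda>w. ((Q w, S1 w), S2 w)) P) = pmf_entropy b (map_pmf (\<lambda>w. (Q w, S1 w, S2 w)) P)"
    by (auto intro!: pmf_entropy_cong_inj)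
  then show ?thesis
    using pmf_entropy_independent[OF ind fin, of b] by (simp add: mutual_info_finite_pmf[OF b fin])
qed

text \<open>After regrouping the variables by system, every entropy splits into a sum.\<close>

lemma mutual_info_add_independent:
  fixes X1 :: "'w \<Rightarrow> 'a::countable" and Y1 :: "'w \<Rightarrow> 'c::countable"
    and X2 :: "'w \<Rightarrow> 'd::countable" and Y2 :: "'w \<Rightarrow> 'e::countable"
  assumes b: "1 < b" and fin: "finite (set_pmf P)"
    and ind: "independent P (\<lambda>w. (X1 w, Y1 w)) (\<lambda>w. (X2 w, Y2 w))"
  shows "mutual_info b P (\<lambda>w. (X1 w, X2 w)) (\<lambda>w. (Y1 w, Y2 w)) = mutual_info b P X1 Y1 + mutual_info b P X2 Y2"
proof -
  have "pmf_entropy b (map_pmf (\<lambda>w. ((X1 w, X2 w), (Y1 w, Y2 w))) P)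
      = pmf_entropy b (map_pmf (\<lambda>w. ((X1 w, Y1 w), (X2 w, Y2 w))) P)"
    by (auto intro!: pmf_entropy_cong_inj)
  moreover have "independent P X1 X2" "independent P Y1 Y2"
    using independent_compose[OF ind, of fst fst] independent_compose[OF ind, of snd snd] by simp_all
  ultimately show ?thesis
    using ind by (simp add: mutual_info_finite_pmf[OF b fin] pmf_entropy_independent fin)
qed

lemma cond_mutual_info_add_independent:
  fixes X1 :: "'w \<Rightarrow> 'a::countable" and Y1 :: "'w \<Rightarrow> 'c::countable" and Z1 :: "'w \<Rightarrow> 'f::countable"
    and X2 :: "'w \<Rightarrow> 'd::countable" and Y2 :: "'w \<Rightarrow> 'e::countable" and Z2 :: "'w \<Rightarrow> 'g::countable"
  assumes b: "1 < b" and fin: "finite (set_pmf P)"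
    and ind: "independent P (\<lambda>w. (X1 w, Y1 w, Z1 w)) (\<lambda>w. (X2 w, Y2 w, Z2 w))"
  shows "cond_mutual_info b P (\<lambda>w. (X1 w, X2 w)) (\<lambda>w. (Y1 w, Y2 w)) (\<lambda>w. (Z1 w, Z2 w))
    = cond_mutual_info b P X1 Y1 Z1 + cond_mutual_info b P X2 Y2 Z2"
proof -
  have
    "pmf_entropy b (map_pmf (\<lambda>w. ((X1 w, X2 w), (Y1 w, Y2 w), (Z1 w, Z2 w))) P)
      = pmf_entropy b (map_pmf (\<lambda>w. ((X1 w, Y1 w, Z1 w), (X2 w, Y2 w, Z2 w))) P)"
    "pmf_entropy b (map_pmf (\<lambda>w. ((X1 w, X2 w), (Z1 w, Z2 w))) P)
      = pmf_entropy b (map_pmf (\<lambda>w. ((X1 w, Z1 w), (X2 w, Z2 w))) P)"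
    "pmf_entropy b (map_pmf (\<lambda>w. ((Y1 w, Y2 w), (Z1 w, Z2 w))) P)
      = pmf_entropy b (map_pmf (\<lambda>w. ((Y1 w, Z1 w), (Y2 w, Z2 w))) P)"
    by (auto intro!: pmf_entropy_cong_inj)
  moreover have "independent P (\<lambda>w. (X1 w, Z1 w)) (\<lambda>w. (X2 w, Z2 w))"
    "independent P (\<lambda>w. (Y1 w, Z1 w)) (\<lambda>w. (Y2 w, Z2 w))" "independent P Z1 Z2"
    using independent_compose[OF ind, of "\<lambda>(x, y, z). (x, z)" "\<lambda>(x, y, z). (x, z)"]
      independent_compose[OF ind, of "\<lambda>(x, y, z). (y, z)" "\<lambda>(x, y, z). (y, z)"]
      independent_compose[OF ind, of "\<lambda>(x, y, z). z" "\<lambda>(x, y, z). z"] by simp_all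
  ultimately show ?thesis
    using ind by (simp add: cond_mutual_info_finite_pmf[OF b fin] pmf_entropy_independent fin)
qed

lemma cond_mutual_info_nonneg:
  fixes X :: "'w \<Rightarrow> 'a::countable" and Y :: "'w \<Rightarrow> 'c::countable" and Z :: "'w \<Rightarrow> 'd::countable"
  assumes "1 < b" "finite (set_pmf P)"
  shows "0 \<le> cond_mutual_info b P X Y Z"
  using pmf_entropy_triple_le[OF assms, of X Y Z] by (simp add: cond_mutual_info_finite_pmf[OF assms])

text \<open>Transfers Griffith-Ho admissibility from the product to its factors; it is applied once
  to the Y side and once to the Z side. The second claim is asymmetric because the chain rule
  assigns (Q,S1) to the second system.\<close>

lemma cond_mutual_info_zero_marginal:
  fixes S1 :: "'w \<Rightarrow> 'a::countable" and S2 :: "'w \<Rightarrow> 'c::countable"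
    and Y1 :: "'w \<Rightarrow> 'd::countable" and Y2 :: "'w \<Rightarrow> 'e::countable" and Q :: "'w \<Rightarrow> 'f::countable"
  assumes b: "1 < b" and fin: "finite (set_pmf P)"
    and ind: "independent P (\<lambda>w. (S1 w, Y1 w)) (\<lambda>w. (S2 w, Y2 w))"
    and zero: "cond_mutual_info b P (\<lambda>w. (S1 w, S2 w)) Q (\<lambda>w. (Y1 w, Y2 w)) = 0"
  shows "cond_mutual_info b P S1 Q Y1 = 0"
    and "cond_mutual_info b P S2 (\<lambda>w. (Q w, S1 w)) Y2 = 0"
proof -
  \<comment> \<open>Together with \<open>ind\<close>, these make I(S1;Y2|Y1) and I(S2;S1Y1|Y2)
    vanish, which is what the two chains below need beyond strong subadditivity.\<close>
  have i: "independent P (\<lambda>w. (S1 w, Y1 w)) Y2" "independent P Y1 Y2"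
    using independent_compose[OF ind, of "\<lambda>x. x" snd] independent_compose[OF ind, of snd snd] by simp_all
  note h = pmf_entropy_independent[OF ind fin, of b] i[THEN pmf_entropy_independent, OF fin, of b]
  note le = pmf_entropy_triple_le[OF b fin]
  note eq = zero[unfolded cond_mutual_info_finite_pmf[OF b fin]]
  \<comment> \<open>Fixes one ordering for each set of variables, so that the inequalities become
    linear in common atoms.\<close>
  have
    "pmf_entropy b (map_pmf (\<lambda>w. ((S1 w, S2 w), Y1 w, Y2 w)) P)
        = pmf_entropy b (map_pmf (\<lambda>w. ((S1 w, Y1 w), S2 w, Y2 w)) P)"
    "pmf_entropy b (map_pmf (\<lambda>w. (S2 w, S1 w, Y1 w, Y2 w)) P)
        = pmf_entropy b (map_pmf (\<lambda>w. ((S1 w, Y1 w), S2 w, Y2 w)) P)"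
    "pmf_entropy b (map_pmf (\<lambda>w. (S1 w, Y1 w, Y2 w)) P) = pmf_entropy b (map_pmf (\<lambda>w. ((S1 w, Y1 w), Y2 w)) P)"
    "pmf_entropy b (map_pmf (\<lambda>w. (S2 w, Q w, S1 w, Y1 w, Y2 w)) P)
        = pmf_entropy b (map_pmf (\<lambda>w. ((S1 w, S2 w), Q w, Y1 w, Y2 w)) P)"
    "pmf_entropy b (map_pmf (\<lambda>w. (S1 w, Y2 w, Q w, Y1 w)) P)
        = pmf_entropy b (map_pmf (\<lambda>w. (Q w, S1 w, Y1 w, Y2 w)) P)"
    "pmf_entropy b (map_pmf (\<lambda>w. (Y2 w, Q w, Y1 w)) P) = pmf_entropy b (map_pmf (\<lambda>w. (Q w, Y1 w, Y2 w)) P)"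
    "pmf_entropy b (map_pmf (\<lambda>w. (S2 w, Y1 w, (Q w, S1 w), Y2 w)) P)
        = pmf_entropy b (map_pmf (\<lambda>w. ((S1 w, S2 w), Q w, Y1 w, Y2 w)) P)"
    "pmf_entropy b (map_pmf (\<lambda>w. (Y1 w, (Q w, S1 w), Y2 w)) P)
        = pmf_entropy b (map_pmf (\<lambda>w. (Q w, S1 w, Y1 w, Y2 w)) P)"
    by (auto intro!: pmf_entropy_cong_inj)
  note perm = this
  \<comment> \<open>\<open>I(S\<^sub>1;Q|Y\<^sub>1) \<le> I(S\<^sub>1;QY\<^sub>2|Y\<^sub>1) = I(S\<^sub>1;Q|Y\<^sub>1Y\<^sub>2) \<le> I(S\<^sub>1S\<^sub>2;Q|Y\<^sub>1Y\<^sub>2) = 0\<close>\<close>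
  have "cond_mutual_info b P S1 Q Y1 \<le> 0"
    using le[of S2 Q "\<lambda>w. (S1 w, Y1 w, Y2 w)"] le[of S1 Y2 "\<lambda>w. (Q w, Y1 w)"] h eq
    unfolding cond_mutual_info_finite_pmf[OF b fin] perm by linarith
  then show "cond_mutual_info b P S1 Q Y1 = 0"
    using cond_mutual_info_nonneg[OF b fin, of S1 Q Y1] by linarith
  \<comment> \<open>\<open>I(S\<^sub>2;QS\<^sub>1|Y\<^sub>2) \<le> I(S\<^sub>2;QS\<^sub>1Y\<^sub>1|Y\<^sub>2) = I(S\<^sub>2;Q|S\<^sub>1Y\<^sub>1Y\<^sub>2) \<le> I(S\<^sub>1S\<^sub>2;Q|Y\<^sub>1Y\<^sub>2) = 0\<close>\<close>
  have "pmf_entropy b (map_pmf (\<lambda>w. (S1 w, Q w, Y1 w, Y2 w)) P)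
      = pmf_entropy b (map_pmf (\<lambda>w. (Q w, S1 w, Y1 w, Y2 w)) P)"
    by (auto intro!: pmf_entropy_cong_inj)
  then have "cond_mutual_info b P S2 (\<lambda>w. (Q w, S1 w)) Y2 \<le> 0"
    using le[of S2 Y1 "\<lambda>w. ((Q w, S1 w), Y2 w)"] le[of S1 Q "\<lambda>w. (Y1 w, Y2 w)"] h eq
    unfolding cond_mutual_info_finite_pmf[OF b fin] perm by linarith
  then show "cond_mutual_info b P S2 (\<lambda>w. (Q w, S1 w)) Y2 = 0"
    using cond_mutual_info_nonneg[OF b fin, of S2 "\<lambda>w. (Q w, S1 w)" Y2] by linarith
qed

section \<open>Products of independent systems\<close>

text \<open>Assumption \<open>ge\<close> is the superadditive half and \<open>le\<close> the
  subadditive half. Domination suffices in both, so data processing can be used where no exact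
  splitting of a value is available.\<close>

lemma Sup_eq_add:
  fixes A B C :: "real set"
  assumes ne: "A \<noteq> {}" "B \<noteq> {}" and bdd: "bdd_above A" "bdd_above B"
    and ge: "\<And>x y. x \<in> A \<Longrightarrow> y \<in> B \<Longrightarrow> \<exists>z\<in>C. x + y \<le> z"
    and le: "\<And>z. z \<in> C \<Longrightarrow> \<exists>x\<in>A. \<exists>y\<in>B. z \<le> x + y"
  shows "Sup C = Sup A + Sup B"
proof (rule antisym)
  have C_le: "z \<le> Sup A + Sup B" if "z \<in> C" for z
    using le[OF that] bdd by (meson add_mono cSup_upper order_trans)
  have "C \<noteq> {}" using ne ge by blast
  then show "Sup C \<le> Sup A + Sup B" by (rule cSup_least) (fact C_le)
  have "bdd_above C" using C_le by (rule bdd_aboveI)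
  then have xy: "x + y \<le> Sup C" if "x \<in> A" "y \<in> B" for x y
    using ge[OF that] by (meson cSup_upper order_trans)
  \<comment> \<open>The suprema are taken one at a time: first over x with y fixed, then over
    y.\<close>
  have "Sup A \<le> Sup C - y" if "y \<in> B" for y
    using ne(1) xy that by (intro cSup_least) (auto simp: algebra_simps)
  then have "Sup B \<le> Sup C - Sup A"
    using ne(2) by (intro cSup_least) (auto simp: algebra_simps)
  then show "Sup A + Sup B \<le> Sup C" by simp
qed

section \<open>The product of two systems\<close>

definition prod_joint ::
  "('s1 \<times> 'y1 \<times> 'z1) pmf \<Rightarrow> ('s2 \<times> 'y2 \<times> 'z2) pmf \<Rightarrow> (('s1 \<times> 's2) \<times> ('y1 \<times> 'y2) \<times> 'z1 \<times> 'z2) pmf" where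
  "prod_joint P1 P2 = map_pmf (\<lambda>((s1, y1, z1), (s2, y2, z2)). ((s1, s2), (y1, y2), (z1, z2))) (pair_pmf P1 P2)"

lemma set_pmf_prod_joint_iff:
  "((s1, s2), (y1, y2), (z1, z2)) \<in> set_pmf (prod_joint P1 P2) \<longleftrightarrow>
    (s1, y1, z1) \<in> set_pmf P1 \<and> (s2, y2, z2) \<in> set_pmf P2"
  by (force simp: prod_joint_def)

text \<open>Reduces the theorem to \<open>prod_joint\<close>: the independence of the two triples
  enters here.\<close>

lemma joint_dist_independent:
  assumes "independent P (\<lambda>w. (S1 w, Y1 w, Z1 w)) (\<lambda>w. (S2 w, Y2 w, Z2 w))"
  shows "joint_dist P (\<lambda>w. (S1 w, S2 w)) (\<lambda>w. (Y1 w, Y2 w)) (\<lambda>w. (Z1 w, Z2 w))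
    = prod_joint (joint_dist P S1 Y1 Z1) (joint_dist P S2 Y2 Z2)"
proof -
  have "pair_pmf (joint_dist P S1 Y1 Z1) (joint_dist P S2 Y2 Z2)
      = map_pmf (\<lambda>w. ((S1 w, Y1 w, Z1 w), (S2 w, Y2 w, Z2 w))) P"
    using assms by (simp add: independent_def joint_dist_def)
  then show ?thesis
    by (simp add: prod_joint_def joint_dist_def pmf.map_comp comp_def)
qed

lemma independent_pair_pmf:
  "independent (pair_pmf A B) (\<lambda>w. f (fst w)) (\<lambda>w. g (snd w))"
proof -
  have "independent (pair_pmf A B) fst snd"
    by (simp add: independent_def map_fst_pair_pmf map_snd_pair_pmf)
  then show ?thesis by (rule independent_compose)
qed

lemma independent_map_pmf:
  "independent (map_pmf h P) X Y \<longleftrightarrow> independent P (\<lambda>w. X (h w)) (\<lambda>w. Y (h w))"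
  by (simp add: independent_def pmf.map_comp comp_def)

lemma independent_prod_joint:
  "independent (prod_joint P1 P2) (\<lambda>((s1, s2), (y1, y2), (z1, z2)). (s1, y1, z1))
    (\<lambda>((s1, s2), (y1, y2), (z1, z2)). (s2, y2, z2))"
  using independent_pair_pmf[of P1 P2 "\<lambda>x. x" "\<lambda>x. x"]
  by (simp add: prod_joint_def independent_map_pmf case_prod_unfold)

lemma map_pmf_prod_joint:
  "map_pmf (\<lambda>((s1, s2), (y1, y2), (z1, z2)). (s1, y1, z1)) (prod_joint P1 P2) = P1"
  "map_pmf (\<lambda>((s1, s2), (y1, y2), (z1, z2)). (s2, y2, z2)) (prod_joint P1 P2) = P2"
  using map_fst_pair_pmf[of P1 P2] map_snd_pair_pmf[of P1 P2]
  by (simp_all add: prod_joint_def pmf.map_comp comp_def case_prod_unfold)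

section \<open>Additivity of information on products\<close>

lemma mutual_info_marginal_fst:
  fixes X :: "'v \<Rightarrow> 'a::countable" and Y :: "'v \<Rightarrow> 'c::countable"
  assumes b: "1 < b" and fin: "finite (set_pmf A)" "finite (set_pmf B)"
  shows "mutual_info b (pair_pmf A B) (\<lambda>w. X (fst w)) (\<lambda>w. Y (fst w)) = mutual_info b A X Y"
  using mutual_info_map_pmf[OF b, of "pair_pmf A B" fst X Y] fin by (simp add: map_fst_pair_pmf)

lemma mutual_info_marginal_snd:
  fixes X :: "'v \<Rightarrow> 'a::countable" and Y :: "'v \<Rightarrow> 'c::countable"
  assumes b: "1 < b" and fin: "finite (set_pmf A)" "finite (set_pmf B)"
  shows "mutual_info b (pair_pmf A B) (\<lambda>w. X (snd w)) (\<lambda>w. Y (snd w)) = mutual_info b B X Y"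
  using mutual_info_map_pmf[OF b, of "pair_pmf A B" snd X Y] fin by (simp add: map_snd_pair_pmf)

lemma cond_mutual_info_marginal_fst:
  fixes X :: "'v \<Rightarrow> 'a::countable" and Y :: "'v \<Rightarrow> 'c::countable" and Z :: "'v \<Rightarrow> 'd::countable"
  assumes b: "1 < b" and fin: "finite (set_pmf A)" "finite (set_pmf B)"
  shows "cond_mutual_info b (pair_pmf A B) (\<lambda>w. X (fst w)) (\<lambda>w. Y (fst w)) (\<lambda>w. Z (fst w))
    = cond_mutual_info b A X Y Z"
  using cond_mutual_info_map_pmf[OF b, of "pair_pmf A B" fst X Y Z] fin by (simp add: map_fst_pair_pmf)

lemma cond_mutual_info_marginal_snd:
  fixes X :: "'v \<Rightarrow> 'a::countable" and Y :: "'v \<Rightarrow> 'c::countable" and Z :: "'v \<Rightarrow> 'd::countable"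
  assumes b: "1 < b" and fin: "finite (set_pmf A)" "finite (set_pmf B)"
  shows "cond_mutual_info b (pair_pmf A B) (\<lambda>w. X (snd w)) (\<lambda>w. Y (snd w)) (\<lambda>w. Z (snd w))
    = cond_mutual_info b B X Y Z"
  using cond_mutual_info_map_pmf[OF b, of "pair_pmf A B" snd X Y Z] fin by (simp add: map_snd_pair_pmf)

lemma mutual_info_pair_pmf:
  fixes X1 :: "'v \<Rightarrow> 'a::countable" and Y1 :: "'v \<Rightarrow> 'c::countable"
    and X2 :: "'w \<Rightarrow> 'd::countable" and Y2 :: "'w \<Rightarrow> 'e::countable"
  assumes b: "1 < b" and fin: "finite (set_pmf A)" "finite (set_pmf B)"
  shows "mutual_info b (pair_pmf A B) (\<lambda>w. (X1 (fst w), X2 (snd w))) (\<lambda>w. (Y1 (fst w), Y2 (snd w)))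
    = mutual_info b A X1 Y1 + mutual_info b B X2 Y2"
  using mutual_info_add_independent[OF b _ independent_pair_pmf[of A B "\<lambda>v. (X1 v, Y1 v)" "\<lambda>w. (X2 w, Y2 w)"]] fin
  by (simp add: mutual_info_marginal_fst[OF b fin] mutual_info_marginal_snd[OF b fin])

lemma cond_mutual_info_pair_pmf:
  fixes X1 :: "'v \<Rightarrow> 'a::countable" and Y1 :: "'v \<Rightarrow> 'c::countable" and Z1 :: "'v \<Rightarrow> 'f::countable"
    and X2 :: "'w \<Rightarrow> 'd::countable" and Y2 :: "'w \<Rightarrow> 'e::countable" and Z2 :: "'w \<Rightarrow> 'g::countable"
  assumes b: "1 < b" and fin: "finite (set_pmf A)" "finite (set_pmf B)"
  shows "cond_mutual_info b (pair_pmf A B) (\<lambda>w. (X1 (fst w), X2 (snd w))) (\<lambda>w. (Y1 (fst w), Y2 (snd w)))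
      (\<lambda>w. (Z1 (fst w), Z2 (snd w)))
    = cond_mutual_info b A X1 Y1 Z1 + cond_mutual_info b B X2 Y2 Z2"
  using cond_mutual_info_add_independent[OF b _
      independent_pair_pmf[of A B "\<lambda>v. (X1 v, Y1 v, Z1 v)" "\<lambda>w. (X2 w, Y2 w, Z2 w)"]] fin
  by (simp add: cond_mutual_info_marginal_fst[OF b fin] cond_mutual_info_marginal_snd[OF b fin])

text \<open>These are the terms other than SI in the equations that determine UI and CI.\<close>

lemma mutual_info_prod_joint:
  fixes P1 :: "('s1::finite \<times> 'y1::finite \<times> 'z1::finite) pmf"
    and P2 :: "('s2::finite \<times> 'y2::finite \<times> 'z2::finite) pmf"
  assumes b: "1 < b"
  shows "mutual_info b (prod_joint P1 P2) (\<lambda>(s, y, z). s) (\<lambda>(s, y, z). y)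
      = mutual_info b P1 (\<lambda>(s, y, z). s) (\<lambda>(s, y, z). y) + mutual_info b P2 (\<lambda>(s, y, z). s) (\<lambda>(s, y, z). y)"
    and "mutual_info b (prod_joint P1 P2) (\<lambda>(s, y, z). s) (\<lambda>(s, y, z). z)
      = mutual_info b P1 (\<lambda>(s, y, z). s) (\<lambda>(s, y, z). z) + mutual_info b P2 (\<lambda>(s, y, z). s) (\<lambda>(s, y, z). z)"
    and "mutual_info b (prod_joint P1 P2) (\<lambda>(s, y, z). s) (\<lambda>(s, y, z). (y, z))
      = mutual_info b P1 (\<lambda>(s, y, z). s) (\<lambda>(s, y, z). (y, z)) + mutual_info b P2 (\<lambda>(s, y, z). s) (\<lambda>(s, y, z). (y, z))"
proof -
  have fin: "finite (set_pmf (pair_pmf P1 P2))" by simp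
  note pair = mutual_info_pair_pmf[OF b finite finite, of P1 P2 "\<lambda>(s, y, z). s" "\<lambda>(s, y, z). s"]
  show "mutual_info b (prod_joint P1 P2) (\<lambda>(s, y, z). s) (\<lambda>(s, y, z). y)
      = mutual_info b P1 (\<lambda>(s, y, z). s) (\<lambda>(s, y, z). y) + mutual_info b P2 (\<lambda>(s, y, z). s) (\<lambda>(s, y, z). y)"
    using pair[of "\<lambda>(s, y, z). y" "\<lambda>(s, y, z). y"]
    by (simp add: prod_joint_def mutual_info_map_pmf[OF b] case_prod_unfold)
  show "mutual_info b (prod_joint P1 P2) (\<lambda>(s, y, z). s) (\<lambda>(s, y, z). z)
      = mutual_info b P1 (\<lambda>(s, y, z). s) (\<lambda>(s, y, z). z) + mutual_info b P2 (\<lambda>(s, y, z). s) (\<lambda>(s, y, z). z)"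
    using pair[of "\<lambda>(s, y, z). z" "\<lambda>(s, y, z). z"]
    by (simp add: prod_joint_def mutual_info_map_pmf[OF b] case_prod_unfold)
  \<comment> \<open>In the product, (Y,Z) is grouped by variable, whereas additivity needs it
    grouped by system.\<close>
  have "pmf_entropy b (map_pmf (\<lambda>w. ((y1 w, y2 w), (z1 w, z2 w))) P)
      = pmf_entropy b (map_pmf (\<lambda>w. ((y1 w, z1 w), (y2 w, z2 w))) P)"
    "pmf_entropy b (map_pmf (\<lambda>w. (s w, (y1 w, y2 w), (z1 w, z2 w))) P)
        = pmf_entropy b (map_pmf (\<lambda>w. (s w, (y1 w, z1 w), (y2 w, z2 w))) P)"
    for s :: "'w \<Rightarrow> 's1 \<times> 's2" and y1 :: "'w \<Rightarrow> 'y1" and y2 :: "'w \<Rightarrow> 'y2" and z1 :: "'w \<Rightarrow> 'z1" and z2 :: "'w \<Rightarrow> 'z2" and P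
    by (auto intro!: pmf_entropy_cong_inj)
  note perm = this
  show "mutual_info b (prod_joint P1 P2) (\<lambda>(s, y, z). s) (\<lambda>(s, y, z). (y, z))
      = mutual_info b P1 (\<lambda>(s, y, z). s) (\<lambda>(s, y, z). (y, z)) + mutual_info b P2 (\<lambda>(s, y, z). s) (\<lambda>(s, y, z). (y, z))"
    using pair[of "\<lambda>(s, y, z). (y, z)" "\<lambda>(s, y, z). (y, z)"]
    by (simp add: prod_joint_def mutual_info_map_pmf[OF b] case_prod_unfold)
       (simp add: mutual_info_finite_pmf[OF b fin] perm)
qed

section \<open>Gacs-Koerner information\<close>

text \<open>\<open>g\<close> codes the section of \<open>f\<close> at y1, so equal codes give equal
  sections. Every pair of support points is possible, hence the same section can be read off from z1
  through \<open>f'\<close>.\<close>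

lemma common_function_of_product:
  fixes P1 :: "('s1::finite \<times> 'y1::finite \<times> 'z1::finite) pmf"
    and P2 :: "('s2::finite \<times> 'y2::finite \<times> 'z2::finite) pmf"
    and f :: "'y1 \<Rightarrow> 'y2 \<Rightarrow> nat"
  assumes eq: "\<forall>(s1, y1, z1) \<in> set_pmf P1. \<forall>(s2, y2, z2) \<in> set_pmf P2. f y1 y2 = f' z1 z2"
  shows "\<exists>(g :: 'y1 \<Rightarrow> nat) (g' :: 'z1 \<Rightarrow> nat). (\<forall>(s, y, z) \<in> set_pmf P1. g y = g' z) \<and>
    (\<forall>(s, t, z) \<in> set_pmf P2. \<forall>y y'. g y = g y' \<longrightarrow> f y t = f y' t)"
proof -
  \<comment> \<open>\<open>f\<close> is unconstrained where the second argument has probability zero, so it is truncated there.\<close>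
  let ?T = "(\<lambda>(s, y, z). y) ` set_pmf P2"
  \<comment> \<open>For each y2 of positive probability, \<open>\<zeta>\<close> picks one z2
    occurring with it, so that f y1 y2 = f' z1 (\<zeta> y2) on the support of
    \<open>P1\<close>.\<close>
  define \<zeta> where "\<zeta> y = (SOME z. \<exists>s. (s, y, z) \<in> set_pmf P2)" for y
  have \<zeta>: "\<exists>s. (s, y, \<zeta> y) \<in> set_pmf P2" if "y \<in> ?T" for y
    unfolding \<zeta>_def by (rule someI_ex) (use that in auto)
  \<comment> \<open>Functions from a finite type to \<open>nat\<close> form a countable type, so a
    whole section can be coded by one number.\<close>
  let ?g = "\<lambda>y1. to_nat (\<lambda>y2. if y2 \<in> ?T then f y1 y2 else 0)"
  let ?g' = "\<lambda>z1. to_nat (\<lambda>y2. if y2 \<in> ?T then f' z1 (\<zeta> y2) else 0)"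
  have "?g y = ?g' z" if "(s, y, z) \<in> set_pmf P1" for s y z
  proof -
    have "(\<lambda>y2. if y2 \<in> ?T then f y y2 else 0) = (\<lambda>y2. if y2 \<in> ?T then f' z (\<zeta> y2) else 0)"
    proof
      fix y2
      show "(if y2 \<in> ?T then f y y2 else 0) = (if y2 \<in> ?T then f' z (\<zeta> y2) else 0)"
        using \<zeta>[of y2] eq that by (cases "y2 \<in> ?T") fastforce+
    qed
    then show ?thesis by simp
  qed
  moreover have "f y y2 = f y' y2" if "?g y = ?g y'" "(s2, y2, z2) \<in> set_pmf P2" for y y' s2 y2 z2
  proof -
    have "y2 \<in> ?T" using that(2) by force
    moreover have "(\<lambda>y2. if y2 \<in> ?T then f y y2 else 0) = (\<lambda>y2. if y2 \<in> ?T then f y' y2 else 0)"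
      using that(1) by simp
    ultimately show ?thesis by (meson fun_cong)
  qed
  ultimately show ?thesis
    by (intro exI[of _ ?g] exI[of _ ?g'] conjI) blast+
qed

lemma SI_wedge_prod_joint:
  fixes P1 :: "('s1::finite \<times> 'y1::finite \<times> 'z1::finite) pmf"
    and P2 :: "('s2::finite \<times> 'y2::finite \<times> 'z2::finite) pmf"
  assumes b: "1 < b"
  shows "SI_wedge b (prod_joint P1 P2) = SI_wedge b P1 + SI_wedge b P2"
proof -
  let ?P = "prod_joint P1 P2"
  have bdd: "bdd_above {mutual_info b P (\<lambda>(s, y, z). f y) (\<lambda>(s, y, z). s) |
      (f :: 'b \<Rightarrow> nat) (f' :: 'c \<Rightarrow> nat). AE (s, y, z) in measure_pmf P. f y = f' z}"
    for P :: "('a::finite \<times> 'b::finite \<times> 'c::finite) pmf"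
    using mutual_info_le_entropy[OF b finite]
    by (intro bdd_aboveI[of _ "pmf_entropy b (map_pmf (\<lambda>(s, y, z). s) P)"]) auto
  have add: "mutual_info b ?P (\<lambda>(s, (y1, y2), z). to_nat (g1 y1, g2 y2)) (\<lambda>(s, y, z). s)
     = mutual_info b P1 (\<lambda>(s, y, z). g1 y) (\<lambda>(s, y, z). s) + mutual_info b P2 (\<lambda>(s, y, z). g2 y) (\<lambda>(s, y, z). s)"
    for g1 :: "'y1 \<Rightarrow> nat" and g2 :: "'y2 \<Rightarrow> nat"
    using mutual_info_pair_pmf[OF b finite finite, where A = P1 and B = P2
        and ?X1.0 = "\<lambda>(s, y, z). g1 y" and ?X2.0 = "\<lambda>(s, y, z). g2 y" and ?Y1.0 = "\<lambda>(s, y, z). s" and ?Y2.0 = "\<lambda>(s, y, z). s"]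
      mutual_info_inj[OF b finite inj_to_nat, where P = "pair_pmf P1 P2"
        and X = "\<lambda>w. (g1 (fst (snd (fst w))), g2 (fst (snd (snd w))))" and Y = "\<lambda>w. (fst (fst w), fst (snd w))"]
    by (simp add: prod_joint_def mutual_info_map_pmf[OF b] case_prod_unfold)
  have AE: "(AE (s, y, z) in measure_pmf ?P. f y = f' z) \<longleftrightarrow>
      (\<forall>(s1, y1, z1) \<in> set_pmf P1. \<forall>(s2, y2, z2) \<in> set_pmf P2. f (y1, y2) = f' (z1, z2))"
    for f :: "'y1 \<times> 'y2 \<Rightarrow> nat" and f' :: "'z1 \<times> 'z2 \<Rightarrow> nat"
    by (auto simp: AE_measure_pmf_iff Ball_def set_pmf_prod_joint_iff)
  show ?thesis
    unfolding SI_wedge_def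
  proof (rule Sup_eq_add[OF _ _ bdd bdd], goal_cases)
    \<comment> \<open>Constant functions are always admissible.\<close>
    case 1 then show ?case by (auto intro!: exI[of _ "\<lambda>_. 0"])
  next
    case 2 then show ?case by (auto intro!: exI[of _ "\<lambda>_. 0"])
  next
    case (3 x y)
    then obtain g1 :: "'y1 \<Rightarrow> nat" and g1' :: "'z1 \<Rightarrow> nat" and g2 :: "'y2 \<Rightarrow> nat" and g2' :: "'z2 \<Rightarrow> nat" where
      "x = mutual_info b P1 (\<lambda>(s, y, z). g1 y) (\<lambda>(s, y, z). s)" "AE (s, y, z) in measure_pmf P1. g1 y = g1' z"
      "y = mutual_info b P2 (\<lambda>(s, y, z). g2 y) (\<lambda>(s, y, z). s)" "AE (s, y, z) in measure_pmf P2. g2 y = g2' z"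
      by blast
    note xy = this
    let ?g = "\<lambda>(y1, y2). to_nat (g1 y1, g2 y2)" and ?g' = "\<lambda>(z1, z2). to_nat (g1' z1, g2' z2)"
    have "AE (s, y, z) in measure_pmf ?P. ?g y = ?g' z"
      unfolding AE using xy(2,4) by (auto simp: AE_measure_pmf_iff)
    moreover have "x + y = mutual_info b ?P (\<lambda>(s, y, z). ?g y) (\<lambda>(s, y, z). s)"
      using add[of g1 g2] xy(1,3) by (simp add: case_prod_unfold)
    ultimately show ?case
      by (intro bexI[of _ "x + y"] CollectI exI[of _ ?g] exI[of _ ?g'] conjI order_refl)
  next
    case (4 v)
    then obtain f :: "'y1 \<times> 'y2 \<Rightarrow> nat" and f' :: "'z1 \<times> 'z2 \<Rightarrow> nat"
      where v: "v = mutual_info b ?P (\<lambda>(s, y, z). f y) (\<lambda>(s, y, z). s)"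
      and f: "AE (s, y, z) in measure_pmf ?P. f y = f' z"
      by blast
    have eq: "\<forall>(s1, y1, z1) \<in> set_pmf P1. \<forall>(s2, y2, z2) \<in> set_pmf P2. f (y1, y2) = f' (z1, z2)"
      using f unfolding AE .
    \<comment> \<open>The same condition with the systems exchanged, for the sections in y2.\<close>
    then have eq': "\<forall>(s2, y2, z2) \<in> set_pmf P2. \<forall>(s1, y1, z1) \<in> set_pmf P1. f (y1, y2) = f' (z1, z2)"
      by blast
    obtain g1 :: "'y1 \<Rightarrow> nat" and g1' :: "'z1 \<Rightarrow> nat" where
      g1: "\<forall>(s, y, z) \<in> set_pmf P1. g1 y = g1' z"
        "\<forall>(s, t, z) \<in> set_pmf P2. \<forall>y y'. g1 y = g1 y' \<longrightarrow> f (y, t) = f (y', t)"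
      using common_function_of_product[of P1 P2 "\<lambda>y1 y2. f (y1, y2)" "\<lambda>z1 z2. f' (z1, z2)", OF eq] by blast
    obtain g2 :: "'y2 \<Rightarrow> nat" and g2' :: "'z2 \<Rightarrow> nat" where
      g2: "\<forall>(s, y, z) \<in> set_pmf P2. g2 y = g2' z"
        "\<forall>(s, t, z) \<in> set_pmf P1. \<forall>y y'. g2 y = g2 y' \<longrightarrow> f (t, y) = f (t, y')"
      using common_function_of_product[of P2 P1 "\<lambda>y2 y1. f (y1, y2)" "\<lambda>z2 z1. f' (z1, z2)", OF eq'] by blast
    have "v \<le> mutual_info b ?P (\<lambda>(s, (y1, y2), z). to_nat (g1 y1, g2 y2)) (\<lambda>(s, y, z). s)"
      unfolding v
    proof (rule mutual_info_data_processing[OF b finite], goal_cases)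
      case (1 w w')
      obtain s1 s2 y1 y2 z1 z2 where w: "w = ((s1, s2), (y1, y2), (z1, z2))" by (metis prod.collapse)
      obtain s1' s2' y1' y2' z1' z2' where w': "w' = ((s1', s2'), (y1', y2'), (z1', z2'))"
        by (metis prod.collapse)
      have supp: "(s2, y2, z2) \<in> set_pmf P2" "(s1', y1', z1') \<in> set_pmf P1" and g: "g1 y1 = g1 y1'" "g2 y2 = g2 y2'"
        using 1 by (simp_all add: w w' set_pmf_prod_joint_iff)
      \<comment> \<open>One coordinate is changed at a time through the hybrid point (y1',y2): y2
        occurs in \<open>P2\<close> because of w, and y1' occurs in \<open>P1\<close> because of
        w'.\<close>
      have "f (y1, y2) = f (y1', y2)" using g1(2) supp(1) g(1) by blast
      also have "\<dots> = f (y1', y2')" using g2(2) supp(2) g(2) by blast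
      finally show ?case by (simp add: w w')
    qed
    moreover have "AE (s, y, z) in measure_pmf P1. g1 y = g1' z" "AE (s, y, z) in measure_pmf P2. g2 y = g2' z"
      using g1(1) g2(1) by (simp_all add: AE_measure_pmf_iff)
    ultimately show ?case
      unfolding add by blast
  qed
qed

section \<open>Griffith-Ho information\<close>

text \<open>Makes a constant Q admissible, so the set of Griffith-Ho values is nonempty.\<close>

lemma cond_mutual_info_const:
  fixes X :: "'w \<Rightarrow> 'a::countable" and Z :: "'w \<Rightarrow> 'd::countable" and c :: "'c::countable"
  assumes "1 < b" "finite (set_pmf P)"
  shows "cond_mutual_info b P X (\<lambda>_. c) Z = 0"
proof -
  have "pmf_entropy b (map_pmf (\<lambda>w. (X w, c, Z w)) P) = pmf_entropy b (map_pmf (\<lambda>w. (X w, Z w)) P)"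
    "pmf_entropy b (map_pmf (\<lambda>w. (c, Z w)) P) = pmf_entropy b (map_pmf Z P)"
    by (auto intro!: pmf_entropy_cong_inj)
  then show ?thesis by (simp add: cond_mutual_info_finite_pmf[OF assms])
qed

definition GH_admissible ::
  "real \<Rightarrow> ('s::finite \<times> 'y::finite \<times> 'z::finite) pmf \<Rightarrow> ('s \<times> 'y \<times> 'z \<times> nat) pmf \<Rightarrow> bool" where
  "GH_admissible b P R \<longleftrightarrow> finite (set_pmf R) \<and> map_pmf (\<lambda>(s, y, z, q). (s, y, z)) R = P \<and>
     cond_mutual_info b R (\<lambda>(s, y, z, q). s) (\<lambda>(s, y, z, q). q) (\<lambda>(s, y, z, q). y) = 0 \<and>
     cond_mutual_info b R (\<lambda>(s, y, z, q). s) (\<lambda>(s, y, z, q). q) (\<lambda>(s, y, z, q). z) = 0"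

definition GH_information :: "real \<Rightarrow> ('s::finite \<times> 'y::finite \<times> 'z::finite \<times> nat) pmf \<Rightarrow> real" where
  "GH_information b R = mutual_info b R (\<lambda>(s, y, z, q). q) (\<lambda>(s, y, z, q). s)"

lemma SI_GH_eq: "SI_GH b P = Sup {GH_information b R | R. GH_admissible b P R}"
  by (simp add: SI_GH_def GH_admissible_def GH_information_def)

text \<open>All extensions share the S-marginal of \<open>P\<close>, so H(S) is a uniform
  bound.\<close>

lemma GH_values_bdd_above:
  assumes b: "1 < b"
  shows "bdd_above {GH_information b R | R. GH_admissible b P R}"
proof (rule bdd_aboveI)
  fix v assume "v \<in> {GH_information b R | R. GH_admissible b P R}"
  then obtain R where v: "v = GH_information b R" and R: "GH_admissible b P R" by blast
  have "map_pmf (\<lambda>(s, y, z, q). s) R = map_pmf fst P"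
    using R by (auto simp: GH_admissible_def pmf.map_comp comp_def case_prod_unfold)
  then show "v \<le> pmf_entropy b (map_pmf fst P)"
    using mutual_info_le_entropy[OF b, of R "\<lambda>(s, y, z, q). q" "\<lambda>(s, y, z, q). s"] R
    by (simp add: v GH_information_def GH_admissible_def)
qed

lemma GH_values_nonempty:
  assumes b: "1 < b"
  shows "{GH_information b R | R. GH_admissible b P R} \<noteq> {}"
proof -
  have "GH_admissible b P (map_pmf (\<lambda>(s, y, z). (s, y, z, 0)) P)"
    by (simp add: GH_admissible_def cond_mutual_info_map_pmf[OF b] cond_mutual_info_const[OF b]
        pmf.map_comp comp_def case_prod_unfold)
  then show ?thesis by blast
qed

lemma SI_GH_prod_joint:
  fixes P1 :: "('s1::finite \<times> 'y1::finite \<times> 'z1::finite) pmf"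
    and P2 :: "('s2::finite \<times> 'y2::finite \<times> 'z2::finite) pmf"
  assumes b: "1 < b"
  shows "SI_GH b (prod_joint P1 P2) = SI_GH b P1 + SI_GH b P2"
  unfolding SI_GH_eq
proof (rule Sup_eq_add[OF GH_values_nonempty[OF b] GH_values_nonempty[OF b]
      GH_values_bdd_above[OF b] GH_values_bdd_above[OF b]])
  fix x y
  assume "x \<in> {GH_information b R | R. GH_admissible b P1 R}"
    and "y \<in> {GH_information b R | R. GH_admissible b P2 R}"
  then obtain R1 R2 where x: "x = GH_information b R1" and R1: "GH_admissible b P1 R1"
    and y: "y = GH_information b R2" and R2: "GH_admissible b P2 R2"
    by blast
  \<comment> \<open>The independent coupling of the two extensions, with the pair (Q1,Q2) coded as
    the new Q.\<close>
  define R where "R = map_pmf (\<lambda>((s1, y1, z1, q1), (s2, y2, z2, q2)).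
    ((s1, s2), (y1, y2), (z1, z2), to_nat (q1, q2))) (pair_pmf R1 R2)"
  have fin: "finite (set_pmf R1)" "finite (set_pmf R2)" "finite (set_pmf (pair_pmf R1 R2))"
    using R1 R2 by (simp_all add: GH_admissible_def)
  have "map_pmf (\<lambda>(s, y, z, q). (s, y, z)) R =
    prod_joint (map_pmf (\<lambda>(s, y, z, q). (s, y, z)) R1) (map_pmf (\<lambda>(s, y, z, q). (s, y, z)) R2)"
    by (simp add: R_def prod_joint_def pmf.map_comp comp_def case_prod_unfold flip: map_pair)
  moreover have "cond_mutual_info b R (\<lambda>(s, y, z, q). s) (\<lambda>(s, y, z, q). q) (\<lambda>(s, y, z, q). y) = 0"
    using cond_mutual_info_pair_pmf[OF b fin(1,2), of "\<lambda>(s, y, z, q). s" "\<lambda>(s, y, z, q). s"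
        "\<lambda>(s, y, z, q). q" "\<lambda>(s, y, z, q). q" "\<lambda>(s, y, z, q). y" "\<lambda>(s, y, z, q). y"] R1 R2 fin
    by (simp add: R_def GH_admissible_def cond_mutual_info_map_pmf[OF b fin(3)]
        cond_mutual_info_inj[OF b fin(3) inj_to_nat] case_prod_unfold)
  moreover have "cond_mutual_info b R (\<lambda>(s, y, z, q). s) (\<lambda>(s, y, z, q). q) (\<lambda>(s, y, z, q). z) = 0"
    using cond_mutual_info_pair_pmf[OF b fin(1,2), of "\<lambda>(s, y, z, q). s" "\<lambda>(s, y, z, q). s"
        "\<lambda>(s, y, z, q). q" "\<lambda>(s, y, z, q). q" "\<lambda>(s, y, z, q). z" "\<lambda>(s, y, z, q). z"] R1 R2 fin
    by (simp add: R_def GH_admissible_def cond_mutual_info_map_pmf[OF b fin(3)]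
        cond_mutual_info_inj[OF b fin(3) inj_to_nat] case_prod_unfold)
  ultimately have "GH_admissible b (prod_joint P1 P2) R"
    using R1 R2 fin by (simp add: GH_admissible_def R_def)
  moreover have "GH_information b R = x + y"
    using mutual_info_pair_pmf[OF b fin(1,2), of "\<lambda>(s, y, z, q). q" "\<lambda>(s, y, z, q). q"
        "\<lambda>(s, y, z, q). s" "\<lambda>(s, y, z, q). s"]
    by (simp add: x y GH_information_def R_def mutual_info_map_pmf[OF b fin(3)]
        mutual_info_inj[OF b fin(3) inj_to_nat] case_prod_unfold)
  ultimately show "\<exists>z\<in>{GH_information b R | R. GH_admissible b (prod_joint P1 P2) R}. x + y \<le> z"
    by (intro bexI[of _ "GH_information b R"] CollectI exI[of _ R] conjI) simp_all
next
  fix v assume "v \<in> {GH_information b R | R. GH_admissible b (prod_joint P1 P2) R}"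
  then obtain R where v: "v = GH_information b R" and R: "GH_admissible b (prod_joint P1 P2) R" by blast
  define S1 :: "('s1 \<times> 's2) \<times> ('y1 \<times> 'y2) \<times> ('z1 \<times> 'z2) \<times> nat \<Rightarrow> 's1" where "S1 = (\<lambda>w. fst (fst w))"
  define S2 :: "('s1 \<times> 's2) \<times> ('y1 \<times> 'y2) \<times> ('z1 \<times> 'z2) \<times> nat \<Rightarrow> 's2" where "S2 = (\<lambda>w. snd (fst w))"
  define Y1 :: "('s1 \<times> 's2) \<times> ('y1 \<times> 'y2) \<times> ('z1 \<times> 'z2) \<times> nat \<Rightarrow> 'y1" where "Y1 = (\<lambda>w. fst (fst (snd w)))"
  define Y2 :: "('s1 \<times> 's2) \<times> ('y1 \<times> 'y2) \<times> ('z1 \<times> 'z2) \<times> nat \<Rightarrow> 'y2" where "Y2 = (\<lambda>w. snd (fst (snd w)))"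
  define Z1 :: "('s1 \<times> 's2) \<times> ('y1 \<times> 'y2) \<times> ('z1 \<times> 'z2) \<times> nat \<Rightarrow> 'z1" where "Z1 = (\<lambda>w. fst (fst (snd (snd w))))"
  define Z2 :: "('s1 \<times> 's2) \<times> ('y1 \<times> 'y2) \<times> ('z1 \<times> 'z2) \<times> nat \<Rightarrow> 'z2" where "Z2 = (\<lambda>w. snd (fst (snd (snd w))))"
  define Q :: "('s1 \<times> 's2) \<times> ('y1 \<times> 'y2) \<times> ('z1 \<times> 'z2) \<times> nat \<Rightarrow> nat" where "Q = (\<lambda>w. snd (snd (snd w)))"
  note vars = S1_def S2_def Y1_def Y2_def Z1_def Z2_def Q_def
  \<comment> \<open>Q itself serves the first system; the second one receives the coded pair (Q,S1),
    as the chain rule requires.\<close>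
  define R1 where "R1 = map_pmf (\<lambda>w. (S1 w, Y1 w, Z1 w, Q w)) R"
  define R2 where "R2 = map_pmf (\<lambda>w. (S2 w, Y2 w, Z2 w, to_nat (Q w, S1 w))) R"
  have fin: "finite (set_pmf R)" using R by (simp add: GH_admissible_def)
  have P: "prod_joint P1 P2 = map_pmf (\<lambda>(s, y, z, q). (s, y, z)) R"
    using R by (simp add: GH_admissible_def)
  \<comment> \<open>Independence of the two systems concerns only the (S,Y,Z)-marginal of
    \<open>R\<close>, however Q depends on them.\<close>
  have ind: "independent R (\<lambda>w. (S1 w, Y1 w, Z1 w)) (\<lambda>w. (S2 w, Y2 w, Z2 w))"
    using independent_prod_joint[of P1 P2] unfolding P independent_map_pmf
    by (simp add: vars case_prod_unfold)
  have ind_Y: "independent R (\<lambda>w. (S1 w, Y1 w)) (\<lambda>w. (S2 w, Y2 w))"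
    and ind_Z: "independent R (\<lambda>w. (S1 w, Z1 w)) (\<lambda>w. (S2 w, Z2 w))"
    and ind_S: "independent R S1 S2"
    using independent_compose[OF ind, of "\<lambda>(s, y, z). (s, y)" "\<lambda>(s, y, z). (s, y)"]
      independent_compose[OF ind, of "\<lambda>(s, y, z). (s, z)" "\<lambda>(s, y, z). (s, z)"]
      independent_compose[OF ind, of fst fst] by simp_all
  have zero_Y: "cond_mutual_info b R (\<lambda>w. (S1 w, S2 w)) Q (\<lambda>w. (Y1 w, Y2 w)) = 0"
    and zero_Z: "cond_mutual_info b R (\<lambda>w. (S1 w, S2 w)) Q (\<lambda>w. (Z1 w, Z2 w)) = 0"
    using R by (simp_all add: GH_admissible_def vars case_prod_unfold)
  have marg: "map_pmf (\<lambda>w. (S1 w, Y1 w, Z1 w)) R = P1" "map_pmf (\<lambda>w. (S2 w, Y2 w, Z2 w)) R = P2"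
    using map_pmf_prod_joint[of P1 P2] unfolding P
    by (simp_all add: vars pmf.map_comp comp_def case_prod_unfold)
  have "GH_admissible b P1 R1"
    using cond_mutual_info_zero_marginal(1)[OF b fin ind_Y zero_Y]
      cond_mutual_info_zero_marginal(1)[OF b fin ind_Z zero_Z] fin marg
    by (simp add: GH_admissible_def R1_def cond_mutual_info_map_pmf[OF b fin] pmf.map_comp comp_def)
  moreover have "GH_admissible b P2 R2"
    using cond_mutual_info_zero_marginal(2)[OF b fin ind_Y zero_Y]
      cond_mutual_info_zero_marginal(2)[OF b fin ind_Z zero_Z] fin marg
    by (simp add: GH_admissible_def R2_def cond_mutual_info_map_pmf[OF b fin] pmf.map_comp comp_def
        cond_mutual_info_inj[OF b fin inj_to_nat])
  moreover have "v = GH_information b R1 + GH_information b R2"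
    using mutual_info_chain_independent[OF b fin ind_S, of Q]
    by (simp add: v GH_information_def R1_def R2_def mutual_info_map_pmf[OF b fin]
        mutual_info_inj[OF b fin inj_to_nat]) (simp add: vars case_prod_unfold)
  ultimately show "\<exists>x\<in>{GH_information b R | R. GH_admissible b P1 R}.
      \<exists>y\<in>{GH_information b R | R. GH_admissible b P2 R}. v \<le> x + y"
    by (intro bexI[of _ "GH_information b R1"] bexI[of _ "GH_information b R2"]) auto
qed

section \<open>Channel-based information\<close>

text \<open>The law of (S,Q) when the channel \<open>L\<close> is applied to Y. The monadic form
  lets the manipulations of channels below follow from the monad laws.\<close>

definition channel_output :: "('s \<times> 'y) pmf \<Rightarrow> ('y \<Rightarrow> 'q pmf) \<Rightarrow> ('s \<times> 'q) pmf" where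
  "channel_output N L = bind_pmf N (\<lambda>(s, y). map_pmf (Pair s) (L y))"

text \<open>Links the monadic form to the matrix equations in the definition of
  \<open>SI_star\<close>.\<close>

lemma channel_output_eq_iff:
  fixes N :: "('s::finite \<times> 'y::finite) pmf"
  shows "R = channel_output N L \<longleftrightarrow> (\<forall>s q. pmf R (s, q) = (\<Sum>y\<in>UNIV. pmf N (s, y) * pmf (L y) q))"
proof -
  have point: "pmf (map_pmf (Pair s') (L y)) (s, q) = of_bool (s' = s) * pmf (L y) q" for s' s :: 's and y q
    by (cases "s' = s") (auto simp: pmf_map_inj' inj_on_def intro!: pmf_map_outside)
  have "pmf (channel_output N L) (s, q) = (\<Sum>y\<in>UNIV. pmf N (s, y) * pmf (L y) q)" for s q
  proof -
    have "pmf (channel_output N L) (s, q) =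
        (\<Sum>x\<in>UNIV. (case x of (s', y) \<Rightarrow> of_bool (s' = s) * pmf (L y) q) * pmf N x)"
      unfolding channel_output_def pmf_bind
      by (subst integral_measure_pmf_real[of UNIV]) (auto simp: point case_prod_unfold)
    also have "\<dots> = (\<Sum>s'\<in>UNIV. of_bool (s' = s) * (\<Sum>y\<in>UNIV. pmf N (s', y) * pmf (L y) q))"
      unfolding UNIV_Times_UNIV[symmetric] sum.cartesian_product'
      by (simp add: sum_distrib_left mult_ac)
    also have "\<dots> = (\<Sum>y\<in>UNIV. pmf N (s, y) * pmf (L y) q)"
      by (simp add: of_bool_def if_distrib[of "\<lambda>x. x * _"] cong: if_cong)
    finally show ?thesis .
  qed
  then show ?thesis by (auto simp: pmf_eq_iff)
qed

text \<open>Two channels used in parallel: independent draws commute, so the systems can be run one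
  after the other. \<open>e\<close> is the coding of output pairs.\<close>

lemma channel_output_pair:
  "channel_output (map_pmf (\<lambda>((s1, y1), (s2, y2)). ((s1, s2), (y1, y2))) (pair_pmf N1 N2))
     (\<lambda>(y1, y2). map_pmf e (pair_pmf (L1 y1) (L2 y2)))
   = map_pmf (\<lambda>((s1, q1), (s2, q2)). ((s1, s2), e (q1, q2)))
       (pair_pmf (channel_output N1 L1) (channel_output N2 L2))"
  by (simp add: channel_output_def pair_pmf_def map_pmf_def bind_assoc_pmf bind_return_pmf case_prod_unfold)
    (intro bind_pmf_cong refl bind_commute_pmf)

text \<open>The second system is independent of the first, so a channel acting on y1 can simulate it
  as internal noise.\<close>

lemma channel_output_marginal_fst:
  "map_pmf (\<lambda>((s1, s2), q). (s1, q))
     (channel_output (map_pmf (\<lambda>((s1, y1), (s2, y2)). ((s1, s2), (y1, y2))) (pair_pmf N1 N2)) L)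
   = channel_output N1 (\<lambda>y1. bind_pmf N2 (\<lambda>(s2, y2). L (y1, y2)))"
  by (simp add: channel_output_def pair_pmf_def map_pmf_def bind_assoc_pmf bind_return_pmf case_prod_unfold)

text \<open>Now the first system is the simulated noise, so the channel knows s1 and can emit it
  together with q. This makes (Q,S1) available to the second system.\<close>

lemma channel_output_marginal_snd:
  "map_pmf (\<lambda>((s1, s2), q). (s2, e (q, s1)))
     (channel_output (map_pmf (\<lambda>((s1, y1), (s2, y2)). ((s1, s2), (y1, y2))) (pair_pmf N1 N2)) L)
   = channel_output N2 (\<lambda>y2. bind_pmf N1 (\<lambda>(s1, y1). map_pmf (\<lambda>q. e (q, s1)) (L (y1, y2))))"
  unfolding channel_output_def pair_pmf_def map_pmf_def bind_assoc_pmf bind_return_pmf case_prod_unfold fst_conv snd_conv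
  by (rule bind_commute_pmf)

lemma map_fst_channel_output: "map_pmf fst (channel_output N L) = map_pmf fst N"
  by (simp add: channel_output_def map_pmf_def bind_assoc_pmf bind_return_pmf case_prod_unfold)

definition star_admissible :: "('s::finite \<times> 'y::finite \<times> 'z::finite) pmf \<Rightarrow> ('s \<times> nat) pmf \<Rightarrow> bool" where
  "star_admissible P R \<longleftrightarrow> (\<exists>L L'. (\<forall>y. finite (set_pmf (L y))) \<and> (\<forall>z. finite (set_pmf (L' z))) \<and>
     R = channel_output (map_pmf (\<lambda>(s, y, z). (s, y)) P) L \<and>
     R = channel_output (map_pmf (\<lambda>(s, y, z). (s, z)) P) L')"

lemma SI_star_eq: "SI_star b P = Sup {mutual_info b R snd fst | R. star_admissible P R}"
proof -
  have proj: "(\<lambda>(s, q). q) = snd" "(\<lambda>(s, q). s) = fst" by auto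
  show ?thesis
    unfolding SI_star_def star_admissible_def channel_output_eq_iff proj all_conj_distrib
    by (intro arg_cong[where f = Sup]) blast
qed

lemma star_admissible_finite: "star_admissible P R \<Longrightarrow> finite (set_pmf R)"
  by (auto simp: star_admissible_def channel_output_def)

lemma star_admissible_fst: "star_admissible P R \<Longrightarrow> map_pmf fst R = map_pmf fst P"
  by (auto simp: star_admissible_def map_fst_channel_output pmf.map_comp comp_def case_prod_unfold)

lemma star_values_bdd_above:
  assumes b: "1 < b"
  shows "bdd_above {mutual_info b R snd fst | R. star_admissible P R}"
proof (rule bdd_aboveI)
  fix v assume "v \<in> {mutual_info b R snd fst | R. star_admissible P R}"
  then obtain R where v: "v = mutual_info b R snd fst" and R: "star_admissible P R" by blast
  show "v \<le> pmf_entropy b (map_pmf fst P)"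
    using mutual_info_le_entropy[OF b star_admissible_finite[OF R], of snd fst]
    by (simp add: v star_admissible_fst[OF R])
qed

lemma star_values_nonempty: "{mutual_info b R snd fst | R. star_admissible P R} \<noteq> {}"
proof -
  \<comment> \<open>Witnessed by the channels that ignore their input and always output 0.\<close>
  have "star_admissible P (map_pmf (\<lambda>(s, y, z). (s, 0)) P)"
    unfolding star_admissible_def
    by (intro exI[of _ "\<lambda>_. return_pmf 0"])
      (simp add: channel_output_def map_pmf_def bind_assoc_pmf bind_return_pmf case_prod_unfold)
  then show ?thesis by blast
qed

lemma SI_star_prod_joint:
  fixes P1 :: "('s1::finite \<times> 'y1::finite \<times> 'z1::finite) pmf"
    and P2 :: "('s2::finite \<times> 'y2::finite \<times> 'z2::finite) pmf"
  assumes b: "1 < b"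
  shows "SI_star b (prod_joint P1 P2) = SI_star b P1 + SI_star b P2"
proof -
  define SY1 where "SY1 = map_pmf (\<lambda>(s, y, z). (s, y)) P1"
  define SY2 where "SY2 = map_pmf (\<lambda>(s, y, z). (s, y)) P2"
  define SZ1 where "SZ1 = map_pmf (\<lambda>(s, y, z). (s, z)) P1"
  define SZ2 where "SZ2 = map_pmf (\<lambda>(s, y, z). (s, z)) P2"
  have adm1: "star_admissible P1 R \<longleftrightarrow> (\<exists>L L'. (\<forall>y. finite (set_pmf (L y))) \<and> (\<forall>z. finite (set_pmf (L' z))) \<and>
      R = channel_output SY1 L \<and> R = channel_output SZ1 L')" for R
    by (simp add: star_admissible_def SY1_def SZ1_def)
  have adm2: "star_admissible P2 R \<longleftrightarrow> (\<exists>L L'. (\<forall>y. finite (set_pmf (L y))) \<and> (\<forall>z. finite (set_pmf (L' z))) \<and>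
      R = channel_output SY2 L \<and> R = channel_output SZ2 L')" for R
    by (simp add: star_admissible_def SY2_def SZ2_def)
  \<comment> \<open>The pair marginals of the product are regrouped products of pair marginals, the
    form in which the channel lemmas apply.\<close>
  have "map_pmf (\<lambda>(s, y, z). (s, y)) (prod_joint P1 P2)
      = map_pmf (\<lambda>((s1, t1), (s2, t2)). ((s1, s2), (t1, t2))) (pair_pmf SY1 SY2)"
    "map_pmf (\<lambda>(s, y, z). (s, z)) (prod_joint P1 P2)
      = map_pmf (\<lambda>((s1, t1), (s2, t2)). ((s1, s2), (t1, t2))) (pair_pmf SZ1 SZ2)"
    by (simp_all add: SY1_def SY2_def SZ1_def SZ2_def prod_joint_def pmf.map_comp comp_def
        case_prod_unfold flip: map_pair)
  then have adm12: "star_admissible (prod_joint P1 P2) R \<longleftrightarrow>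
      (\<exists>L L'. (\<forall>y. finite (set_pmf (L y))) \<and> (\<forall>z. finite (set_pmf (L' z))) \<and>
      R = channel_output (map_pmf (\<lambda>((s1, t1), (s2, t2)). ((s1, s2), (t1, t2))) (pair_pmf SY1 SY2)) L \<and>
      R = channel_output (map_pmf (\<lambda>((s1, t1), (s2, t2)). ((s1, s2), (t1, t2))) (pair_pmf SZ1 SZ2)) L')" for R
    by (simp add: star_admissible_def)
  show ?thesis
    unfolding SI_star_eq
  proof (rule Sup_eq_add[OF star_values_nonempty star_values_nonempty
        star_values_bdd_above[OF b] star_values_bdd_above[OF b]])
    fix x y
    assume "x \<in> {mutual_info b R snd fst | R. star_admissible P1 R}"
      and "y \<in> {mutual_info b R snd fst | R. star_admissible P2 R}"
    then obtain R1 R2 where x: "x = mutual_info b R1 snd fst" and R1: "star_admissible P1 R1"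
      and y: "y = mutual_info b R2 snd fst" and R2: "star_admissible P2 R2"
      by blast
    obtain L1 L1' where L1: "\<And>y. finite (set_pmf (L1 y))" "\<And>z. finite (set_pmf (L1' z))"
      "R1 = channel_output SY1 L1" "R1 = channel_output SZ1 L1'"
      using R1 unfolding adm1 by blast
    obtain L2 L2' where L2: "\<And>y. finite (set_pmf (L2 y))" "\<And>z. finite (set_pmf (L2' z))"
      "R2 = channel_output SY2 L2" "R2 = channel_output SZ2 L2'"
      using R2 unfolding adm2 by blast
    \<comment> \<open>The output of the parallel channels, with the pair of outputs coded as a
      number.\<close>
    define R where "R = map_pmf (\<lambda>((s1, q1), (s2, q2)). ((s1, s2), to_nat (q1, q2))) (pair_pmf R1 R2)"
    have finR: "finite (set_pmf (pair_pmf R1 R2))"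
      using star_admissible_finite[OF R1] star_admissible_finite[OF R2] by simp
    have "star_admissible (prod_joint P1 P2) R"
      unfolding adm12
    proof (intro exI conjI)
      show "R = channel_output (map_pmf (\<lambda>((s1, y1), (s2, y2)). ((s1, s2), (y1, y2))) (pair_pmf SY1 SY2))
          (\<lambda>(y1, y2). map_pmf to_nat (pair_pmf (L1 y1) (L2 y2)))"
        unfolding channel_output_pair R_def L1(3)[symmetric] L2(3)[symmetric] ..
      show "R = channel_output (map_pmf (\<lambda>((s1, y1), (s2, y2)). ((s1, s2), (y1, y2))) (pair_pmf SZ1 SZ2))
          (\<lambda>(z1, z2). map_pmf to_nat (pair_pmf (L1' z1) (L2' z2)))"
        unfolding channel_output_pair R_def L1(4)[symmetric] L2(4)[symmetric] ..
    qed (use L1 L2 in auto)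
    moreover have "mutual_info b R snd fst = x + y"
      using mutual_info_pair_pmf[OF b star_admissible_finite[OF R1] star_admissible_finite[OF R2], of snd snd fst fst]
      by (simp add: x y R_def mutual_info_map_pmf[OF b finR]
          mutual_info_inj[OF b finR inj_to_nat] case_prod_unfold)
    ultimately show "\<exists>z\<in>{mutual_info b R snd fst | R. star_admissible (prod_joint P1 P2) R}. x + y \<le> z"
      by (intro bexI[of _ "mutual_info b R snd fst"] CollectI exI[of _ R] conjI) simp_all
  next
    fix v assume "v \<in> {mutual_info b R snd fst | R. star_admissible (prod_joint P1 P2) R}"
    then obtain R where v: "v = mutual_info b R snd fst" and R: "star_admissible (prod_joint P1 P2) R" by blast
    obtain L L' where L: "\<And>y. finite (set_pmf (L y))" "\<And>z. finite (set_pmf (L' z))"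
      and RY: "R = channel_output (map_pmf (\<lambda>((s1, t1), (s2, t2)). ((s1, s2), (t1, t2))) (pair_pmf SY1 SY2)) L"
      and RZ: "R = channel_output (map_pmf (\<lambda>((s1, t1), (s2, t2)). ((s1, s2), (t1, t2))) (pair_pmf SZ1 SZ2)) L'"
      using R unfolding adm12 by blast
    \<comment> \<open>As in the Griffith-Ho case, Q goes to the first system and (Q,S1) to the
      second; the channels that realise them average \<open>L\<close> and \<open>L'\<close> over the
      other system.\<close>
    define R1 where "R1 = map_pmf (\<lambda>((s1, s2), q). (s1, q)) R"
    define R2 where "R2 = map_pmf (\<lambda>((s1, s2), q). (s2, to_nat (q, s1))) R"
    note finR = star_admissible_finite[OF R]
    have "star_admissible P1 R1"
      unfolding adm1
    proof (intro exI conjI)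
      show "R1 = channel_output SY1 (\<lambda>y1. bind_pmf SY2 (\<lambda>(s2, y2). L (y1, y2)))"
        unfolding R1_def RY by (rule channel_output_marginal_fst)
      show "R1 = channel_output SZ1 (\<lambda>z1. bind_pmf SZ2 (\<lambda>(s2, z2). L' (z1, z2)))"
        unfolding R1_def RZ by (rule channel_output_marginal_fst)
    qed (use L in auto)
    moreover have "star_admissible P2 R2"
      unfolding adm2
    proof (intro exI conjI)
      show "R2 = channel_output SY2
          (\<lambda>y2. bind_pmf SY1 (\<lambda>(s1, y1). map_pmf (\<lambda>q. to_nat (q, s1)) (L (y1, y2))))"
        unfolding R2_def RY by (rule channel_output_marginal_snd)
      show "R2 = channel_output SZ2
          (\<lambda>z2. bind_pmf SZ1 (\<lambda>(s1, z1). map_pmf (\<lambda>q. to_nat (q, s1)) (L' (z1, z2))))"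
        unfolding R2_def RZ by (rule channel_output_marginal_snd)
    qed (use L in auto)
    moreover have "independent (prod_joint P1 P2) (\<lambda>w. fst (fst w)) (\<lambda>w. snd (fst w))"
      using independent_compose[OF independent_prod_joint[of P1 P2], of fst fst]
      by (simp add: case_prod_unfold)
    \<comment> \<open>A channel leaves the S-marginal unchanged, so S1 and S2 are still independent
      under \<open>R\<close>.\<close>
    then have "independent R (\<lambda>w. fst (fst w)) (\<lambda>w. snd (fst w))"
      using independent_map_pmf[of fst R fst snd] independent_map_pmf[of fst "prod_joint P1 P2" fst snd]
      by (simp add: star_admissible_fst[OF R])
    from mutual_info_chain_independent[OF b finR this, of snd]
    have "v = mutual_info b R1 snd fst + mutual_info b R2 snd fst"
      by (simp add: v R1_def R2_def mutual_info_map_pmf[OF b finR]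
          mutual_info_inj[OF b finR inj_to_nat] case_prod_unfold)
    ultimately show "\<exists>x\<in>{mutual_info b R snd fst | R. star_admissible P1 R}.
        \<exists>y\<in>{mutual_info b R snd fst | R. star_admissible P2 R}. v \<le> x + y"
      by (intro bexI[of _ "mutual_info b R1 snd fst"] bexI[of _ "mutual_info b R2 snd fst"]) auto
  qed
qed

section \<open>Additivity of shared, unique and complementary information\<close>

theorem theorem13:
  fixes b :: real
    and P :: "'w pmf"
    and S1 :: "'w \<Rightarrow> 's1::finite" and Y1 :: "'w \<Rightarrow> 'y1::finite" and Z1 :: "'w \<Rightarrow> 'z1::finite"
    and S2 :: "'w \<Rightarrow> 's2::finite" and Y2 :: "'w \<Rightarrow> 'y2::finite" and Z2 :: "'w \<Rightarrow> 'z2::finite"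
    and P1 :: "('s1 \<times> 'y1 \<times> 'z1) pmf"
    and P2 :: "('s2 \<times> 'y2 \<times> 'z2) pmf"
    and P12 :: "(('s1 \<times> 's2) \<times> ('y1 \<times> 'y2) \<times> ('z1 \<times> 'z2)) pmf"
  assumes "1 < b"
    and "independent P (\<lambda>w. (S1 w, Y1 w, Z1 w)) (\<lambda>w. (S2 w, Y2 w, Z2 w))"
    and "P1 = joint_dist P S1 Y1 Z1"
    and "P2 = joint_dist P S2 Y2 Z2"
    and "P12 = joint_dist P (\<lambda>w. (S1 w, S2 w)) (\<lambda>w. (Y1 w, Y2 w)) (\<lambda>w. (Z1 w, Z2 w))"
  shows
    "(SI_wedge b P12 = SI_wedge b P1 + SI_wedge b P2 \<and>
      UI_Y SI_wedge b P12 = UI_Y SI_wedge b P1 + UI_Y SI_wedge b P2 \<and>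
      UI_Z SI_wedge b P12 = UI_Z SI_wedge b P1 + UI_Z SI_wedge b P2 \<and>
      CI SI_wedge b P12 = CI SI_wedge b P1 + CI SI_wedge b P2) \<and>
     (SI_GH b P12 = SI_GH b P1 + SI_GH b P2 \<and>
      UI_Y SI_GH b P12 = UI_Y SI_GH b P1 + UI_Y SI_GH b P2 \<and>
      UI_Z SI_GH b P12 = UI_Z SI_GH b P1 + UI_Z SI_GH b P2 \<and>
      CI SI_GH b P12 = CI SI_GH b P1 + CI SI_GH b P2) \<and>
     (SI_star b P12 = SI_star b P1 + SI_star b P2 \<and>
      UI_Y SI_star b P12 = UI_Y SI_star b P1 + UI_Y SI_star b P2 \<and>
      UI_Z SI_star b P12 = UI_Z SI_star b P1 + UI_Z SI_star b P2 \<and>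
      CI SI_star b P12 = CI SI_star b P1 + CI SI_star b P2)"
proof -
  have P12: "P12 = prod_joint P1 P2"
    unfolding assms(3-5) using assms(2) by (rule joint_dist_independent)
  show ?thesis
    \<comment> \<open>UI and CI are linear combinations of SI and mutual informations, all of which
      are additive.\<close>
    unfolding P12 UI_Y_def UI_Z_def CI_def SI_wedge_prod_joint[OF assms(1)] SI_GH_prod_joint[OF assms(1)]
      SI_star_prod_joint[OF assms(1)] mutual_info_prod_joint[OF assms(1)]
    by (simp add: algebra_simps)
qed

end
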